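(* Consider the linear Gaussian model $\mathbf{Y}=\widetilde{\mathbf{X}}\mathbf{H}+\mathbf{V}$ with the joint-cum-group-sparse parameterized prior on $\mathbf{H}\in\mathbb{C}^{NMR\times K}$ described in the context, with hyperparameters $\underline{\boldsymbol\psi}=(\underline\psi_1,\dots,\underline\psi_{R/d})\in(0,\infty)^{R/d}$ and $\mathbf{\Psi}_{JG}=\mathbf{I}_M\otimes(\mathbf{I}_N\otimes(\mathrm{diag}[\underline\psi_1,\dots,\underline\psi_{R/d}]\otimes\mathbf{I}_d))$. Fix an observation $\mathbf{Y}\in\mathbb{C}^{M(L+R-1)\times K}$. Let $l\ge1$, let the previous estimates $\widehat{\underline\psi}_i^{(l-1)}>0$, $1\le i\le R/d$, be given, put $\widehat{\mathbf{\Psi}}_{JG}^{(l-1)}=\mathbf{I}_M\otimes(\mathbf{I}_N\otimes(\mathrm{diag}[\widehat{\underline\psi}_1^{(l-1)},\dots,\widehat{\underline\psi}_{R/d}^{(l-1)}]\otimes\mathbf{I}_d))$, and define $$\mathbf{\Sigma}_{JG}^{(l)}=\left(\widetilde{\mathbf{X}}^H\mathbf{R}_v^{-1}\widetilde{\mathbf{X}}+\left(\widehat{\mathbf{\Psi}}_{JG}^{(l-1)}\right)^{-1}\right)^{-1},\qquad \boldsymbol{\mathcal{M}}_{JG}^{(l)}=\mathbf{\Sigma}_{JG}^{(l)}\widetilde{\mathbf{X}}^H\mathbf{R}_v^{-1}\mathbf{Y}.$$ Then the hyperparameters $\widehat{\underline{\boldsymbol\psi}}^{(l)}$ that maximize,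 over $\underline{\boldsymbol\psi}\in(0,\infty)^{R/d}$, the EM objective $$\mathbb{E}_{\mathbf{H}|\mathbf{Y};\widehat{\mathbf{\Psi}}_{JG}^{(l-1)}}\left\{\log p\left(\mathbf{Y},\mathbf{H};\mathbf{\Psi}_{JG}\right)\right\}$$ are given, for each $1\le i\le R/d$, by $$\widehat{\underline\psi}_i^{(l)}=\frac{1}{dNMK}\sum_{n=1}^{N}\sum_{m=1}^{M}\sum_{k=1}^{K}\sum_{j=(i-1)d+1}^{id}\left|\boldsymbol{\mathcal{M}}_{JG}^{(l)}(\bar m+j,k)\right|^2+\frac{1}{dNM}\sum_{n=1}^{N}\sum_{m=1}^{M}\sum_{j=(i-1)d+1}^{id}\mathbf{\Sigma}_{JG}^{(l)}(\bar m+j,\bar m+j),$$ where $\bar m=\bar m(m,n)=(m-1)NR+(n-1)R$.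
   Context: $N,M,R,K,L$ are positive integers (numbers of transmit antennas, receive antennas, range bins, pulses, and transmit samples), and $d$ (the group length) is a positive integer dividing $R$. For each $n=1,\dots,N$, given complex numbers $x_n[1],\dots,x_n[L]$, $\mathbf{X}_n\in\mathbb{C}^{(L+R-1)\times R}$ is the Toeplitz convolution matrix with $(a,b)$ entry $x_n[a-b+1]$ when $1\le a-b+1\le L$ and $0$ otherwise. $\mathbf{X}=[\mathbf{X}_1,\dots,\mathbf{X}_N]\in\mathbb{C}^{(L+R-1)\times NR}$ and $\widetilde{\mathbf{X}}=\mathbf{I}_M\otimes\mathbf{X}\in\mathbb{C}^{M(L+R-1)\times NMR}$. Observation model: $\mathbf{Y}=\widetilde{\mathbf{X}}\mathbf{H}+\mathbf{V}$, where the columns of $\mathbf{V}\in\mathbb{C}^{M(L+R-1)\times K}$ are independent circularly symmetric complex Gaussian $\mathcal{CN}(\mathbf{0},\mathbf{R}_v)$ vectors with $\mathbf{R}_v$ a (known) Hermitian positive definite matrix, independent of $\mathbf{H}$. Thus $p(\mathbf{Y}|\mathbf{H})$ is the corresponding Gaussian density and does not depend on the hyperparameters. Channel vectors: the $k$-th column of $\mathbf{H}$ is obtained by stacking vectors $\mathbf{h}_{n,m,k}\in\mathbb{C}^R$, first over the transmit index $n=1,\dots,N$ and then over the receive index $m=1,\dots,M$; that is, $\mathbf{h}_{n,m,k}(j)=\mathbf{H}((m-1)NR+(n-1)R+j,\,k)$ for $1\le j\le R$. Joint-cum-group-sparse prior: the density of $\mathbf{H}$ with respect to Lebesgue measure on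 $\mathbb{C}^{NMR\times K}$ is $$p(\mathbf{H};\mathbf{\Psi}_{JG})=\prod_{n=1}^{N}\prod_{m=1}^{M}\prod_{k=1}^{K}\prod_{i=1}^{R/d}\frac{1}{(\pi\underline\psi_i)^d}\exp\left(-\frac{\sum_{j=(i-1)d+1}^{id}|\mathbf{h}_{n,m,k}(j)|^2}{\underline\psi_i}\right).$$ The joint density is $p(\mathbf{Y},\mathbf{H};\mathbf{\Psi}_{JG})=p(\mathbf{Y}|\mathbf{H})\,p(\mathbf{H};\mathbf{\Psi}_{JG})$, and $\mathbb{E}_{\mathbf{H}|\mathbf{Y};\widehat{\mathbf{\Psi}}_{JG}^{(l-1)}}\{\cdot\}$ denotes expectation over $\mathbf{H}$ under its posterior (conditional) distribution given $\mathbf{Y}$ in the model with hyperparameter matrix $\widehat{\mathbf{\Psi}}_{JG}^{(l-1)}$. $\mathbf{\Sigma}_{JG}^{(l)}$ and $\boldsymbol{\mathcal{M}}_{JG}^{(l)}$ are called the posterior covariance and mean matrices. *)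

theory Defs
  imports "HOL-Analysis.Analysis" "Jordan_Normal_Form.Schur_Decomposition"
    "Jordan_Normal_Form.Gauss_Jordan_Elimination"
begin

unbundle no vec_syntax
unbundle no inner_syntax

(* All indices start at 0 instead of 1: n < N, m < M, k < K, i < R div d, j < R,
   and the sample x_n[t], 1 <= t <= L, is x (n-1) (t-1). *)

section \<open>Matrices\<close>

definition kron :: "complex mat \<Rightarrow> complex mat \<Rightarrow> complex mat" (infixr \<open>\<otimes>\<^sub>K\<close> 75) where
  "A \<otimes>\<^sub>K B = Matrix.mat (dim_row A * dim_row B) (dim_col A * dim_col B)
     (\<lambda>(i, j). A $$ (i div dim_row B, j div dim_col B) * B $$ (i mod dim_row B, j mod dim_col B))"

(* The inverse of A if A is invertible; unspecified otherwise. *)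
definition mat_inv :: "complex mat \<Rightarrow> complex mat" where
  "mat_inv A = the (mat_inverse A)"

definition hermitian_pos_def :: "nat \<Rightarrow> complex mat \<Rightarrow> bool" where
  "hermitian_pos_def p A \<longleftrightarrow> A \<in> carrier_mat p p \<and> mat_adjoint A = A \<and>
     (\<forall>v \<in> carrier_vec p. v \<noteq> 0\<^sub>v p \<longrightarrow> 0 < Re ((A *\<^sub>v v) \<bullet>c v))"

definition pos_vecs :: "nat \<Rightarrow> real Matrix.vec set" where
  "pos_vecs r = {v \<in> carrier_vec r. \<forall>i<r. 0 < v $ i}"

section \<open>Transmit waveform matrices\<close>

definition conv_mat :: "nat \<Rightarrow> nat \<Rightarrow> (nat \<Rightarrow> complex) \<Rightarrow> complex mat" where
  "conv_mat L R y = Matrix.mat (L + R - 1) R (\<lambda>(a, b). if b \<le> a \<and> a - b < L then y (a - b) else 0)"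

definition waveform_mat :: "nat \<Rightarrow> nat \<Rightarrow> nat \<Rightarrow> (nat \<Rightarrow> nat \<Rightarrow> complex) \<Rightarrow> complex mat" where
  "waveform_mat N L R x =
     Matrix.mat (L + R - 1) (N * R) (\<lambda>(a, c). conv_mat L R (x (c div R)) $$ (a, c mod R))"

definition obs_mat :: "nat \<Rightarrow> nat \<Rightarrow> nat \<Rightarrow> nat \<Rightarrow> (nat \<Rightarrow> nat \<Rightarrow> complex) \<Rightarrow> complex mat" where
  "obs_mat N M L R x = 1\<^sub>m M \<otimes>\<^sub>K waveform_mat N L R x"

section \<open>Densities\<close>

(* Lebesgue measure on the space of complex nr x nc matrices: the product of the two-dimensional
   Lebesgue measures of the entries, transported along the bijection sending a family of entries
   to the matrix. *)
definition lborel_mat :: "nat \<Rightarrow> nat \<Rightarrow> complex mat measure" where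
  "lborel_mat nr nc =
     embed_measure (Pi\<^sub>M ({..<nr} \<times> {..<nc}) (\<lambda>_. lborel)) (Matrix.mat nr nc)"

lemma inj_on_mat_entries:
  "inj_on (Matrix.mat nr nc)
     (space (Pi\<^sub>M ({..<nr} \<times> {..<nc}) (\<lambda>_. lborel :: complex measure)))"
proof (rule inj_onI)
  fix f g :: "nat \<times> nat \<Rightarrow> complex"
  assume "f \<in> space (Pi\<^sub>M ({..<nr} \<times> {..<nc}) (\<lambda>_. lborel))"
    and "g \<in> space (Pi\<^sub>M ({..<nr} \<times> {..<nc}) (\<lambda>_. lborel))"
  then have fg: "f \<in> ({..<nr} \<times> {..<nc}) \<rightarrow>\<^sub>E UNIV" "g \<in> ({..<nr} \<times> {..<nc}) \<rightarrow>\<^sub>E UNIV"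
    by (simp_all add: space_PiM)
  assume eq: "Matrix.mat nr nc f = Matrix.mat nr nc g"
  show "f = g"
  proof (rule PiE_ext[OF fg])
    fix p assume "p \<in> {..<nr} \<times> {..<nc}"
    then obtain i j where p: "p = (i, j)" "i < nr" "j < nc" by auto
    have "Matrix.mat nr nc f $$ (i, j) = Matrix.mat nr nc g $$ (i, j)" by (simp add: eq)
    then show "f p = g p" using p by simp
  qed
qed

lemma space_lborel_mat: "space (lborel_mat nr nc) = carrier_mat nr nc"
proof (intro equalityI subsetI)
  fix A :: "complex mat" assume "A \<in> space (lborel_mat nr nc)"
  then show "A \<in> carrier_mat nr nc"
    by (auto simp: lborel_mat_def space_embed_measure)
next
  fix A :: "complex mat" assume A: "A \<in> carrier_mat nr nc"
  let ?f = "restrict (\<lambda>p. A $$ p) ({..<nr} \<times> {..<nc})"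
  have "?f \<in> space (Pi\<^sub>M ({..<nr} \<times> {..<nc}) (\<lambda>_. lborel))" by (simp add: space_PiM)
  moreover have "A = Matrix.mat nr nc ?f" using A by (intro eq_matI) auto
  ultimately show "A \<in> space (lborel_mat nr nc)"
    unfolding lborel_mat_def space_embed_measure by blast
qed

(* Density of CN(0, S); for Hermitian positive definite S, the determinant and the quadratic form
   v^H S^-1 v are real. *)
definition cn_density :: "complex mat \<Rightarrow> complex Matrix.vec \<Rightarrow> real" where
  "cn_density S v =
     1 / (pi ^ dim_row S * Re (Determinant.det S)) * exp (- Re ((mat_inv S *\<^sub>v v) \<bullet>c v))"

definition noise_density :: "complex mat \<Rightarrow> complex mat \<Rightarrow> real" where
  "noise_density Rv V = (\<Prod>k<dim_col V. cn_density Rv (Matrix.col V k))"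

(* p(Y | H) for Y = Xt H + V *)
definition likelihood :: "complex mat \<Rightarrow> complex mat \<Rightarrow> complex mat \<Rightarrow> complex mat \<Rightarrow> real" where
  "likelihood Xt Rv Y H = noise_density Rv (Y - Xt * H)"

definition channel_vec ::
  "nat \<Rightarrow> nat \<Rightarrow> complex mat \<Rightarrow> nat \<Rightarrow> nat \<Rightarrow> nat \<Rightarrow> complex Matrix.vec" where
  "channel_vec N R H n m k = Matrix.vec R (\<lambda>j. H $$ (m * N * R + n * R + j, k))"

definition prior_density ::
  "nat \<Rightarrow> nat \<Rightarrow> nat \<Rightarrow> nat \<Rightarrow> nat \<Rightarrow> real Matrix.vec \<Rightarrow> complex mat \<Rightarrow> real" where
  "prior_density N M R K d \<psi> H =
     (\<Prod>n<N. \<Prod>m<M. \<Prod>k<K. \<Prod>i<R div d.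
        1 / (pi * \<psi> $ i) ^ d *
        exp (- (\<Sum>j = i * d..<(i + 1) * d. (cmod (channel_vec N R H n m k $ j))\<^sup>2) / \<psi> $ i))"

definition joint_density ::
  "nat \<Rightarrow> nat \<Rightarrow> nat \<Rightarrow> nat \<Rightarrow> nat \<Rightarrow> complex mat \<Rightarrow> complex mat \<Rightarrow> real Matrix.vec \<Rightarrow>
   complex mat \<Rightarrow> complex mat \<Rightarrow> real" where
  "joint_density N M R K d Xt Rv \<psi> Y H = likelihood Xt Rv Y H * prior_density N M R K d \<psi> H"

(* Conditional distribution of H given Y, by Bayes' rule. *)
definition posterior ::
  "nat \<Rightarrow> nat \<Rightarrow> nat \<Rightarrow> nat \<Rightarrow> nat \<Rightarrow> complex mat \<Rightarrow> complex mat \<Rightarrow> real Matrix.vec \<Rightarrow>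
   complex mat \<Rightarrow> complex mat measure" where
  "posterior N M R K d Xt Rv \<psi> Y =
     density (lborel_mat (N * M * R) K)
       (\<lambda>H. ennreal (joint_density N M R K d Xt Rv \<psi> Y H /
          (\<integral>H'. joint_density N M R K d Xt Rv \<psi> Y H' \<partial>lborel_mat (N * M * R) K)))"

section \<open>The EM step\<close>

definition EM_objective ::
  "nat \<Rightarrow> nat \<Rightarrow> nat \<Rightarrow> nat \<Rightarrow> nat \<Rightarrow> complex mat \<Rightarrow> complex mat \<Rightarrow> complex mat \<Rightarrow>
   real Matrix.vec \<Rightarrow> real Matrix.vec \<Rightarrow> real" where
  "EM_objective N M R K d Xt Rv Y \<psi>_old \<psi> =
     (\<integral>H. ln (joint_density N M R K d Xt Rv \<psi> Y H) \<partial>posterior N M R K d Xt Rv \<psi>_old Y)"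

definition Psi_JG :: "nat \<Rightarrow> nat \<Rightarrow> nat \<Rightarrow> nat \<Rightarrow> real Matrix.vec \<Rightarrow> complex mat" where
  "Psi_JG N M R d \<psi> =
     1\<^sub>m M \<otimes>\<^sub>K (1\<^sub>m N \<otimes>\<^sub>K (mat_diag (R div d) (\<lambda>i. complex_of_real (\<psi> $ i)) \<otimes>\<^sub>K 1\<^sub>m d))"

definition post_cov :: "complex mat \<Rightarrow> complex mat \<Rightarrow> complex mat \<Rightarrow> complex mat" where
  "post_cov Xt Rv \<Psi> = mat_inv (mat_adjoint Xt * mat_inv Rv * Xt + mat_inv \<Psi>)"

definition post_mean ::
  "complex mat \<Rightarrow> complex mat \<Rightarrow> complex mat \<Rightarrow> complex mat \<Rightarrow> complex mat" where
  "post_mean Xt Rv \<Psi> Y = post_cov Xt Rv \<Psi> * mat_adjoint Xt * mat_inv Rv * Y"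

end

theory Submission
  imports Defs "HOL-Probability.Distributions"
begin

unbundle no vec_syntax
unbundle no inner_syntax

text \<open>
  The negative logarithm of the posterior density is, up to a constant, a quadratic energy of the
  channel matrix. Let \<open>\<mu>\<close> and \<open>\<Sigma>\<close> be the posterior mean and covariance of one column. Moving the column
  along \<open>u = \<Sigma> e\<^sub>p / \<Sigma>\<^sub>p\<^sub>p\<close>, whose \<open>p\<close>-th entry is 1, from any point with \<open>p\<close>-th entry \<open>\<mu>\<^sub>p\<close> by the
  multiple \<open>t\<close> raises the energy by exactly \<open>|t|\<^sup>2 / \<Sigma>\<^sub>p\<^sub>p\<close>. A shear, which preserves Lebesgue measure,
  therefore splits off the \<open>p\<close>-th entry, whose marginal is the complex normal law with mean \<open>\<mu>\<^sub>p\<close> and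
  variance \<open>\<Sigma>\<^sub>p\<^sub>p\<close>; no normalizing determinant has to be computed. With the second moments
  \<open>|\<mu>\<^sub>p|\<^sup>2 + \<Sigma>\<^sub>p\<^sub>p\<close> the EM objective becomes a constant plus a sum over \<open>i\<close> of
  \<open>- C ln (\<pi> \<psi>\<^sub>i) - T\<^sub>i / \<psi>\<^sub>i\<close>, whose unique maximizer \<open>T\<^sub>i / C\<close> is read off from \<open>ln x \<le> x - 1\<close>.
\<close>

section \<open>Complex normal integrals\<close>

lemma measurable_Complex [measurable]:
  "(\<lambda>(x, y). Complex x y) \<in> borel \<Otimes>\<^sub>M borel \<rightarrow>\<^sub>M borel"
proof -
  have "(\<lambda>(x, y). Complex x y) = (\<lambda>z. complex_of_real (fst z) + \<i> * complex_of_real (snd z))"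
    by (auto simp: Complex_eq)
  then show ?thesis by simp
qed

text \<open>A box in the Euclidean space \<open>complex\<close> is a rectangle in the real and
  imaginary parts, so both measures give it the same volume, and volumes of boxes characterize
  Lebesgue measure. This opens complex integrals to the theory of real normal densities.\<close>

lemma lborel_complex:
  "(lborel :: complex measure) = distr (lborel \<Otimes>\<^sub>M lborel) borel (\<lambda>(x, y). Complex x y)"
proof (rule lborel_eqI)
  fix l u :: complex
  assume le: "\<And>b. b \<in> Basis \<Longrightarrow> inner l b \<le> inner u b"
  have re: "Re l \<le> Re u" and im: "Im l \<le> Im u"
    using le[of 1] le[of \<i>] by (auto simp: Basis_complex_def inner_complex_def)
  have vim: "(\<lambda>(x, y). Complex x y) -` box l u \<inter> space (lborel \<Otimes>\<^sub>M lborel)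
      = {Re l<..<Re u} \<times> {Im l<..<Im u}"
    by (auto simp: box_def Basis_complex_def inner_complex_def space_pair_measure)
  have "emeasure (distr (lborel \<Otimes>\<^sub>M lborel) borel (\<lambda>(x, y). Complex x y)) (box l u)
      = emeasure (lborel \<Otimes>\<^sub>M lborel) ({Re l<..<Re u} \<times> {Im l<..<Im u})"
    by (subst emeasure_distr) (simp_all add: vim)
  also have "\<dots> = ennreal (Re u - Re l) * ennreal (Im u - Im l)"
    using re im by (subst lborel.emeasure_pair_measure_Times) simp_all
  also have "\<dots> = ennreal (\<Prod>b\<in>Basis. inner (u - l) b)"
    using re im by (simp add: Basis_complex_def inner_complex_def ennreal_mult)
  finally show "emeasure (distr (lborel \<Otimes>\<^sub>M lborel) borel (\<lambda>(x, y). Complex x y)) (box l u)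
      = ennreal (\<Prod>b\<in>Basis. inner (u - l) b)" .
qed simp

lemma nn_integral_complex:
  fixes f :: "complex \<Rightarrow> ennreal"
  assumes [measurable]: "f \<in> borel_measurable borel"
  shows "(\<integral>\<^sup>+z. f z \<partial>lborel) = (\<integral>\<^sup>+x. \<integral>\<^sup>+y. f (Complex x y) \<partial>lborel \<partial>lborel)"
proof -
  have "(\<integral>\<^sup>+z. f z \<partial>lborel) = (\<integral>\<^sup>+(x, y). f (Complex x y) \<partial>(lborel \<Otimes>\<^sub>M lborel))"
    by (subst lborel_complex, subst nn_integral_distr) (auto intro!: nn_integral_cong)
  also have "\<dots> = (\<integral>\<^sup>+x. \<integral>\<^sup>+y. f (Complex x y) \<partial>lborel \<partial>lborel)"
    by (subst lborel.nn_integral_fst [symmetric]) simp_all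
  finally show ?thesis .
qed

text \<open>The circularly symmetric law CN(m, s). The parameter \<open>s\<close> is the full
  variance, the expectation of |z - m|^2, and not a standard deviation as in
  \<open>normal_density\<close>; each of the two real coordinates has variance s/2.\<close>

definition complex_normal_density :: "complex \<Rightarrow> real \<Rightarrow> complex \<Rightarrow> real" where
  "complex_normal_density m s z = exp (- (cmod (z - m))\<^sup>2 / s) / (pi * s)"

lemma complex_normal_density_nonneg [simp]: "0 < s \<Longrightarrow> 0 \<le> complex_normal_density m s z"
  by (simp add: complex_normal_density_def)

lemma measurable_complex_normal_density [measurable]: "complex_normal_density m s \<in> borel_measurable borel"
  unfolding complex_normal_density_def by measurable

lemma complex_normal_density_Complex:
  assumes s: "0 < s"
  shows "complex_normal_density m s (Complex x y)
    = normal_density (Re m) (sqrt (s / 2)) x * normal_density (Im m) (sqrt (s / 2)) y"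
  using s by (simp add: complex_normal_density_def normal_density_def cmod_power2 exp_add [symmetric]
      diff_divide_distrib)

lemma nn_integral_normal_density:
  "0 < \<sigma> \<Longrightarrow> (\<integral>\<^sup>+x. ennreal (normal_density m \<sigma> x) \<partial>lborel) = 1"
  by (simp add: nn_integral_eq_integral)

lemma nn_integral_normal_density_square:
  assumes \<sigma>: "0 < \<sigma>"
  shows "(\<integral>\<^sup>+x. ennreal (normal_density m \<sigma> x * x\<^sup>2) \<partial>lborel) = ennreal (m\<^sup>2 + \<sigma>\<^sup>2)"
proof -
  \<comment> \<open>The decomposition x^2 = (x - m)^2 + 2 m x - m^2 reduces the claim to central
    moments of orders 2 and 0 and the mean. The exponents \<open>2 * 1\<close> and
    \<open>2 * 0\<close> are written to match \<open>normal_moment_even\<close>.\<close>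
  have "has_bochner_integral lborel (\<lambda>x. normal_density m \<sigma> x * (x - m) ^ (2 * 1)
      + 2 * m * (normal_density m \<sigma> x * x) - m\<^sup>2 * (normal_density m \<sigma> x * (x - m) ^ (2 * 0)))
      (fact (2 * 1) / ((2 / \<sigma>\<^sup>2) ^ 1 * fact 1) + 2 * m * m 
        - m\<^sup>2 * (fact (2 * 0) / ((2 / \<sigma>\<^sup>2) ^ 0 * fact 0)))"
    by (intro has_bochner_integral_add has_bochner_integral_diff has_bochner_integral_mult_right
        normal_moment_even normal_moment_nz_1 \<sigma>)
  then have "has_bochner_integral lborel (\<lambda>x. normal_density m \<sigma> x * x\<^sup>2) (m\<^sup>2 + \<sigma>\<^sup>2)"
    by (rule has_bochner_integral_cong [THEN iffD1, rotated -1])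
      (use \<sigma> in \<open>auto simp: power2_eq_square field_simps\<close>)
  then show ?thesis
    by (subst nn_integral_eq_integral) (auto simp: has_bochner_integral_iff)
qed

lemma nn_integral_complex_normal_density:
  assumes s: "0 < s"
  shows "(\<integral>\<^sup>+z. ennreal (complex_normal_density m s z) \<partial>lborel) = 1"
  using s by (simp add: nn_integral_complex complex_normal_density_Complex ennreal_mult nn_integral_cmult
      nn_integral_multc nn_integral_normal_density)

text \<open>Each real coordinate contributes its squared mean plus s/2. As a nonnegative integral,
  the result later gives integrability together with the value.\<close>

lemma nn_integral_complex_normal_density_square:
  assumes s: "0 < s"
  shows "(\<integral>\<^sup>+z. ennreal ((cmod z)\<^sup>2) * ennreal (complex_normal_density m s z) \<partial>lborel) = ennreal ((cmod m)\<^sup>2 + s)"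
proof -
  let ?n = "\<lambda>a. normal_density a (sqrt (s / 2))"
  have "(\<integral>\<^sup>+z. ennreal ((cmod z)\<^sup>2) * ennreal (complex_normal_density m s z) \<partial>lborel)
      = (\<integral>\<^sup>+x. \<integral>\<^sup>+y. ennreal (?n (Re m) x * x\<^sup>2) * ennreal (?n (Im m) y)
          + ennreal (?n (Re m) x) * ennreal (?n (Im m) y * y\<^sup>2) \<partial>lborel \<partial>lborel)"
    using s by (subst nn_integral_complex, simp)
      (auto intro!: nn_integral_cong simp: complex_normal_density_Complex cmod_power2 algebra_simps
        simp flip: ennreal_mult ennreal_plus)
  also have "\<dots> = ennreal ((Re m)\<^sup>2 + s / 2) + ennreal ((Im m)\<^sup>2 + s / 2)"
    using s by (simp add: nn_integral_add nn_integral_cmult nn_integral_multc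
        nn_integral_normal_density nn_integral_normal_density_square)
  also have "\<dots> = ennreal ((cmod m)\<^sup>2 + s)"
    using s by (simp add: cmod_power2 flip: ennreal_plus)
  finally show ?thesis .
qed

text \<open>The preimage of a product set is a product of translated sets, so translation invariance
  in each coordinate is enough. On a slice where one coordinate is frozen, the shear used below is
  such a translation.\<close>

lemma distr_PiM_lborel_translate:
  fixes c :: "'i \<Rightarrow> 'a :: euclidean_space"
  assumes J: "finite J"
  shows "distr (Pi\<^sub>M J (\<lambda>_. lborel)) (Pi\<^sub>M J (\<lambda>_. lborel)) (\<lambda>x. \<lambda>i\<in>J. c i + x i)
    = Pi\<^sub>M J (\<lambda>_. lborel)"
proof -
  interpret P: product_sigma_finite "\<lambda>_::'i. lborel :: 'a measure" by standard
  let ?t = "\<lambda>x. \<lambda>i\<in>J. c i + x i"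
  have [measurable]: "?t \<in> Pi\<^sub>M J (\<lambda>_. lborel) \<rightarrow>\<^sub>M Pi\<^sub>M J (\<lambda>_. lborel)"
    by measurable
  show ?thesis
  proof (rule P.PiM_eqI [OF J])
    fix A :: "'i \<Rightarrow> 'a set" assume A: "\<And>i. i \<in> J \<Longrightarrow> A i \<in> sets lborel"
    have B: "(+) (c i) -` A i \<in> sets lborel" if "i \<in> J" for i
      using measurable_sets [of "(+) (c i)" lborel lborel "A i"] A [OF that] by simp
    have "emeasure (distr (Pi\<^sub>M J (\<lambda>_. lborel)) (Pi\<^sub>M J (\<lambda>_. lborel)) ?t) (Pi\<^sub>E J A)
        = emeasure (Pi\<^sub>M J (\<lambda>_. lborel)) (Pi\<^sub>E J (\<lambda>i. (+) (c i) -` A i))"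
      using A J by (subst emeasure_distr)
        (auto intro!: sets_PiM_I_finite arg_cong [where f = "emeasure _"] simp: space_PiM PiE_iff)
    also have "\<dots> = (\<Prod>i\<in>J. emeasure lborel ((+) (c i) -` A i))"
      by (rule P.emeasure_PiM [OF J B])
    also have "\<dots> = (\<Prod>i\<in>J. emeasure (distr lborel borel ((+) (c i))) (A i))"
      using A by (intro prod.cong refl) (subst emeasure_distr, auto)
    also have "\<dots> = (\<Prod>i\<in>J. emeasure lborel (A i))"
      by (simp add: lborel_distr_plus)
    finally show "emeasure (distr (Pi\<^sub>M J (\<lambda>_. lborel)) (Pi\<^sub>M J (\<lambda>_. lborel)) ?t) (Pi\<^sub>E J A)
      = (\<Prod>i\<in>J. emeasure lborel (A i))" .
  qed simp
qed

text \<open>Slice by the value y of coordinate \<open>p\<close>. Translation by the multiple y - m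
  of \<open>u\<close> carries the slice at \<open>m\<close> onto the slice at y and raises
  \<open>E\<close> by |y - m|^2 / s, so every slice integral is a Gaussian factor times one
  constant. That constant is never evaluated, and the identity also holds if the total mass is
  infinite.\<close>

lemma nn_integral_gaussian_marginal:
  fixes E :: "('i \<Rightarrow> complex) \<Rightarrow> real" and \<phi> :: "complex \<Rightarrow> ennreal"
  assumes I: "finite I" "p \<in> I" and s: "0 < s" and up: "u p = 1"
    and E[measurable]: "E \<in> borel_measurable (Pi\<^sub>M I (\<lambda>_. lborel))"
    and \<phi>[measurable]: "\<phi> \<in> borel_measurable borel"
    and shift: "\<And>a t. a \<in> extensional I \<Longrightarrow> a p = m \<Longrightarrow>
        E (\<lambda>i\<in>I. a i + t * u i) = E a + (cmod t)\<^sup>2 / s"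
  shows "(\<integral>\<^sup>+f. \<phi> (f p) * ennreal (exp (- E f)) \<partial>Pi\<^sub>M I (\<lambda>_. lborel))
    = (\<integral>\<^sup>+z. \<phi> z * ennreal (complex_normal_density m s z) \<partial>lborel)
        * (\<integral>\<^sup>+f. ennreal (exp (- E f)) \<partial>Pi\<^sub>M I (\<lambda>_. lborel))"
proof -
  interpret P: product_sigma_finite "\<lambda>_::'i. lborel :: complex measure" by standard
  define J where "J = I - {p}"
  have J: "finite J" "p \<notin> J" and IJ: "insert p J = I" using I by (auto simp: J_def)
  have E'[measurable]: "E \<in> borel_measurable (Pi\<^sub>M (insert p J) (\<lambda>_. lborel))"
    using E by (simp add: IJ)
  define C where "C = (\<integral>\<^sup>+x. ennreal (exp (- E (x(p := m)))) \<partial>Pi\<^sub>M J (\<lambda>_. lborel))"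
  have inner: "(\<integral>\<^sup>+x. ennreal (exp (- E (x(p := y)))) \<partial>Pi\<^sub>M J (\<lambda>_. lborel))
      = ennreal (pi * s) * ennreal (complex_normal_density m s y) * C" for y
  proof -
    let ?t = "\<lambda>x. \<lambda>i\<in>J. (y - m) * u i + x i"
    have "(\<integral>\<^sup>+x. ennreal (exp (- E (x(p := y)))) \<partial>Pi\<^sub>M J (\<lambda>_. lborel))
        = (\<integral>\<^sup>+x. ennreal (exp (- E ((?t x)(p := y)))) \<partial>Pi\<^sub>M J (\<lambda>_. lborel))"
      by (subst distr_PiM_lborel_translate [OF J(1), symmetric], subst nn_integral_distr) simp_all
    also have "\<dots> = (\<integral>\<^sup>+x. ennreal (exp (- (cmod (y - m))\<^sup>2 / s)) *
        ennreal (exp (- E (x(p := m)))) \<partial>Pi\<^sub>M J (\<lambda>_. lborel))"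
    proof (intro nn_integral_cong)
      fix x :: "'i \<Rightarrow> complex" assume "x \<in> space (Pi\<^sub>M J (\<lambda>_. lborel))"
      then have x: "x \<in> extensional J" by (auto simp: space_PiM PiE_iff)
      let ?a = "x(p := m)"
      have a: "?a \<in> extensional I" using x IJ by (auto simp: extensional_def)
      \<comment> \<open>At \<open>p\<close> itself this uses \<open>u p = 1\<close>: the entry
        \<open>m\<close> becomes m + (y - m) = y.\<close>
      have eq: "(?t x)(p := y) = (\<lambda>i\<in>I. ?a i + (y - m) * u i)"
        using J up x by (auto simp: fun_eq_iff IJ [symmetric] extensional_def)
      show "ennreal (exp (- E ((?t x)(p := y)))) = ennreal (exp (- (cmod (y - m))\<^sup>2 / s)) *
        ennreal (exp (- E ?a))"
        by (subst eq, subst shift [OF a])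
          (simp_all add: exp_diff exp_minus divide_inverse mult.commute flip: ennreal_mult)
    qed
    also have "\<dots> = ennreal (exp (- (cmod (y - m))\<^sup>2 / s)) * C"
      unfolding C_def by (rule nn_integral_cmult) (use J in measurable)
    also have "ennreal (exp (- (cmod (y - m))\<^sup>2 / s)) = ennreal (pi * s) * ennreal (complex_normal_density m s y)"
      using s by (simp add: complex_normal_density_def flip: ennreal_mult)
    finally show ?thesis .
  qed
  \<comment> \<open>Proved for every test function because it is used twice: for the given one, and
    for the constant 1, which identifies \<open>ennreal (pi * s) * C\<close> as the total
    mass.\<close>
  have gen: "(\<integral>\<^sup>+f. \<phi> (f p) * ennreal (exp (- E f)) \<partial>Pi\<^sub>M I (\<lambda>_. lborel))
      = (\<integral>\<^sup>+z. \<phi> z * ennreal (complex_normal_density m s z) \<partial>lborel) * (ennreal (pi * s) * C)"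
    if [measurable]: "\<phi> \<in> borel_measurable borel" for \<phi> :: "complex \<Rightarrow> ennreal"
  proof -
    have "(\<integral>\<^sup>+f. \<phi> (f p) * ennreal (exp (- E f)) \<partial>Pi\<^sub>M I (\<lambda>_. lborel))
      = (\<integral>\<^sup>+y. \<integral>\<^sup>+x. \<phi> y * ennreal (exp (- E (x(p := y)))) \<partial>Pi\<^sub>M J (\<lambda>_. lborel) \<partial>lborel)"
      by (subst IJ [symmetric], subst P.product_nn_integral_insert_rev [OF J]) simp_all
    also have "\<dots> = (\<integral>\<^sup>+y. \<phi> y * ennreal (complex_normal_density m s y) * (ennreal (pi * s) * C) \<partial>lborel)"
      using J by (intro nn_integral_cong, subst nn_integral_cmult) (simp_all add: inner mult_ac)
    also have "\<dots> = (\<integral>\<^sup>+z. \<phi> z * ennreal (complex_normal_density m s z) \<partial>lborel) * (ennreal (pi * s) * C)"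
      by (rule nn_integral_multc) measurable
    finally show ?thesis .
  qed
  show ?thesis
    using gen [OF \<phi>] gen [of "\<lambda>_. 1"] s by (simp add: nn_integral_complex_normal_density)
qed

section \<open>Hermitian positive definite matrices\<close>

lemma dim_mat_adjoint [simp]:
  "dim_row (mat_adjoint A) = dim_col A" "dim_col (mat_adjoint A) = dim_row A"
  by (simp_all add: mat_adjoint_def)

lemma mat_adjoint_carrier [simp]:
  "A \<in> carrier_mat nr nc \<Longrightarrow> mat_adjoint A \<in> carrier_mat nc nr"
  by (intro carrier_matI) auto

lemma index_mat_adjoint:
  fixes A :: "complex mat"
  assumes "A \<in> carrier_mat nr nc" "i < nc" "j < nr"
  shows "mat_adjoint A $$ (i, j) = cnj (A $$ (j, i))"
  using assms by (auto simp: mat_adjoint_def mat_of_rows_def)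

lemma mat_adjoint_mult:
  fixes A B :: "complex mat"
  assumes A: "A \<in> carrier_mat nr n" and B: "B \<in> carrier_mat n nc"
  shows "mat_adjoint (A * B) = mat_adjoint B * mat_adjoint A"
proof (rule eq_matI)
  have AB: "A * B \<in> carrier_mat nr nc" using A B by simp
  have dims: "mat_adjoint A \<in> carrier_mat n nr" "mat_adjoint B \<in> carrier_mat nc n"
    "mat_adjoint (A * B) \<in> carrier_mat nc nr"
    using A B AB by (auto intro: mat_adjoint_carrier)
  show "dim_row (mat_adjoint (A * B)) = dim_row (mat_adjoint B * mat_adjoint A)"
    "dim_col (mat_adjoint (A * B)) = dim_col (mat_adjoint B * mat_adjoint A)"
    using dims by auto
  fix i j assume "i < dim_row (mat_adjoint B * mat_adjoint A)"
    "j < dim_col (mat_adjoint B * mat_adjoint A)"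
  then have ij: "i < nc" "j < nr" using dims by auto
  show "mat_adjoint (A * B) $$ (i, j) = (mat_adjoint B * mat_adjoint A) $$ (i, j)"
    using A B dims ij index_mat_adjoint [OF AB ij] index_mat_adjoint [OF A]
      index_mat_adjoint [OF B]
    by (auto simp: scalar_prod_def mult.commute intro!: sum.cong)
qed

lemma mat_adjoint_add:
  fixes A B :: "complex mat"
  assumes A: "A \<in> carrier_mat nr nc" and B: "B \<in> carrier_mat nr nc"
  shows "mat_adjoint (A + B) = mat_adjoint A + mat_adjoint B"
proof (rule eq_matI)
  have AB: "A + B \<in> carrier_mat nr nc" using A B by simp
  have dims: "mat_adjoint A \<in> carrier_mat nc nr" "mat_adjoint B \<in> carrier_mat nc nr"
    "mat_adjoint (A + B) \<in> carrier_mat nc nr"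
    using A B AB by (auto intro: mat_adjoint_carrier)
  show "dim_row (mat_adjoint (A + B)) = dim_row (mat_adjoint A + mat_adjoint B)"
    "dim_col (mat_adjoint (A + B)) = dim_col (mat_adjoint A + mat_adjoint B)"
    using dims by auto
  fix i j assume "i < dim_row (mat_adjoint A + mat_adjoint B)"
    "j < dim_col (mat_adjoint A + mat_adjoint B)"
  then have ij: "i < nc" "j < nr" using dims by auto
  show "mat_adjoint (A + B) $$ (i, j) = (mat_adjoint A + mat_adjoint B) $$ (i, j)"
    using A B dims ij index_mat_adjoint [OF AB ij] index_mat_adjoint [OF A ij]
      index_mat_adjoint [OF B ij] by auto
qed

lemma mat_adjoint_adjoint:
  fixes A :: "complex mat"
  assumes A: "A \<in> carrier_mat nr nc"
  shows "mat_adjoint (mat_adjoint A) = A"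
proof (rule eq_matI)
  have "mat_adjoint (mat_adjoint A) \<in> carrier_mat nr nc"
    by (intro mat_adjoint_carrier A)
  then show "dim_row (mat_adjoint (mat_adjoint A)) = dim_row A"
    "dim_col (mat_adjoint (mat_adjoint A)) = dim_col A" using A by auto
  fix i j assume "i < dim_row A" "j < dim_col A"
  then show "mat_adjoint (mat_adjoint A) $$ (i, j) = A $$ (i, j)"
    using A index_mat_adjoint [OF mat_adjoint_carrier [OF A], of i j]
      index_mat_adjoint [OF A, of j i] by auto
qed

lemma cscalar_prod_sum:
  "w \<in> carrier_vec n \<Longrightarrow> v \<bullet>c w = (\<Sum>i<n. v $ i * cnj (w $ i))"
  by (simp add: scalar_prod_def lessThan_atLeast0)

lemma cscalar_prod_commute:
  fixes v w :: "complex Matrix.vec"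
  assumes "v \<in> carrier_vec n" "w \<in> carrier_vec n"
  shows "w \<bullet>c v = cnj (v \<bullet>c w)"
  using assms by (simp add: cscalar_prod_sum mult.commute)

lemma cscalar_prod_adjoint:
  fixes A :: "complex mat"
  assumes A: "A \<in> carrier_mat nr nc" and v: "v \<in> carrier_vec nc" and w: "w \<in> carrier_vec nr"
  shows "(A *\<^sub>v v) \<bullet>c w = v \<bullet>c (mat_adjoint A *\<^sub>v w)"
proof -
  have Aw: "mat_adjoint A *\<^sub>v w \<in> carrier_vec nc"
    using mat_adjoint_carrier [OF A] w by (rule mult_mat_vec_carrier)
  have "(A *\<^sub>v v) \<bullet>c w = (\<Sum>i<nr. \<Sum>j<nc. A $$ (i, j) * v $ j * cnj (w $ i))"
    unfolding cscalar_prod_sum [OF w] using A v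
    by (intro sum.cong refl) (simp add: scalar_prod_def sum_distrib_right lessThan_atLeast0)
  also have "\<dots> = (\<Sum>j<nc. \<Sum>i<nr. A $$ (i, j) * v $ j * cnj (w $ i))"
    by (rule sum.swap)
  also have "\<dots> = (\<Sum>j<nc. v $ j * cnj ((mat_adjoint A *\<^sub>v w) $ j))"
    using A w
    by (intro sum.cong refl)
      (simp add: scalar_prod_def sum_distrib_left lessThan_atLeast0 index_mat_adjoint [OF A]
        mult_ac)
  also have "\<dots> = v \<bullet>c (mat_adjoint A *\<^sub>v w)"
    by (simp add: cscalar_prod_sum [OF Aw])
  finally show ?thesis .
qed

lemma hermitian_pos_defD:
  assumes "hermitian_pos_def n A"
  shows "A \<in> carrier_mat n n" "mat_adjoint A = A"
    "\<And>v. v \<in> carrier_vec n \<Longrightarrow> v \<noteq> 0\<^sub>v n \<Longrightarrow> 0 < Re ((A *\<^sub>v v) \<bullet>c v)"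
  using assms by (auto simp: hermitian_pos_def_def)

lemma hermitian_pos_def_nonneg:
  assumes A: "hermitian_pos_def n A" and v: "v \<in> carrier_vec n"
  shows "0 \<le> Re ((A *\<^sub>v v) \<bullet>c v)"
proof (cases "v = 0\<^sub>v n")
  case True
  then show ?thesis using hermitian_pos_defD(1) [OF A] by (simp add: cscalar_prod_sum [OF v])
next
  case False
  then show ?thesis using hermitian_pos_defD(3) [OF A v] by simp
qed

lemma hermitian_pos_def_selfadjoint:
  assumes A: "hermitian_pos_def n A" and "v \<in> carrier_vec n" "w \<in> carrier_vec n"
  shows "(A *\<^sub>v v) \<bullet>c w = v \<bullet>c (A *\<^sub>v w)"
  using cscalar_prod_adjoint [of A n n v w] hermitian_pos_defD [OF A] assms by simp

lemma poly_prod_list: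
  "poly (\<Prod>a\<leftarrow>as. f a) x = (\<Prod>a\<leftarrow>as. poly (f a) x)"
  by (induction as) auto

text \<open>The determinant is the product of the eigenvalues. Self-adjointness makes each
  eigenvalue real, and positivity of the form at an eigenvector makes it positive. The result serves
  both invertibility and the positivity of the normalizing constant of the noise density.\<close>

lemma det_hermitian_pos_def:
  assumes hA: "hermitian_pos_def n A"
  shows "0 < Re (Determinant.det A)"
proof -
  note A = hermitian_pos_defD(1) [OF hA]
  obtain as where as: "char_poly A = (\<Prod>a\<leftarrow>as. [:- a, 1:])" "length as = n"
    using char_poly_factorized [OF A] by blast
  have pos: "\<exists>r > 0. a = complex_of_real r" if "a \<in> set as" for a
  proof -
    have "poly (char_poly A) a = 0"
      using that unfolding as(1) poly_prod_list by (auto simp: prod_list_zero_iff)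
    then obtain v where v: "v \<in> carrier_vec n" "v \<noteq> 0\<^sub>v n" "A *\<^sub>v v = a \<cdot>\<^sub>v v"
      using A by (auto simp: eigenvalue_root_char_poly [OF A, symmetric] eigenvalue_def
          eigenvector_def)
    define q where "q = v \<bullet>c v"
    have q: "(A *\<^sub>v v) \<bullet>c v = a * q" "v \<bullet>c (A *\<^sub>v v) = cnj a * q"
      unfolding v(3) q_def using v(1)
      by (simp_all add: cscalar_prod_sum [of _ n] sum_distrib_left mult_ac)
    define Q where "Q = (\<Sum>i<n. (cmod (v $ i))\<^sup>2)"
    have qr: "q = complex_of_real Q"
      by (simp only: q_def Q_def cscalar_prod_sum [OF v(1)] complex_norm_square of_real_sum)
    have "0 < Re (a * q)"
      using hermitian_pos_defD(3) [OF hA v(1,2)] q by simp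
    moreover have "0 \<le> Q" by (simp add: Q_def sum_nonneg)
    ultimately have r: "0 < Re a" and q0: "q \<noteq> 0"
      by (auto simp: qr zero_less_mult_iff)
    have "a * q = cnj a * q"
      using hermitian_pos_def_selfadjoint [OF hA v(1) v(1)] q by simp
    then have "a = cnj a" using q0 by simp
    then have "Im a = 0" by (simp add: complex_eq_iff)
    then show ?thesis using r by (intro exI [of _ "Re a"]) (simp add: complex_eq_iff)
  qed
  \<comment> \<open>Evaluating the characteristic polynomial at 0 gives the determinant of
    \<open>- A\<close>; the sign (-1)^n then appears on both sides and cancels.\<close>
  have "Determinant.det (- A) = poly (char_poly A) 0"
    unfolding char_poly_matrix [OF A] using A
    by (intro arg_cong [where f = Determinant.det] eq_matI) (auto simp: char_matrix_def)
  also have "\<dots> = (\<Prod>a\<leftarrow>as. - a)"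
    unfolding as(1) poly_prod_list by simp
  also have "\<dots> = (- 1) ^ n * prod_list as"
    unfolding as(2) [symmetric] by (induction as) auto
  also have "Determinant.det (- A) = (- 1) ^ n * Determinant.det A"
  proof -
    have "- A = (- 1) \<cdot>\<^sub>m A" by (rule eq_matI) auto
    then show ?thesis using A by (simp add: det_smult)
  qed
  finally have "Determinant.det A = prod_list as" by simp
  moreover have "\<exists>r > 0. prod_list as = complex_of_real r"
    using pos
  proof (induction as)
    case (Cons a as)
    obtain r where "0 < r" "a = complex_of_real r" using Cons.prems [of a] by auto
    moreover obtain r' where "0 < r'" "prod_list as = complex_of_real r'"
      using Cons.IH Cons.prems by (meson list.set_intros(2))
    ultimately show ?case by (intro exI [of _ "r * r'"]) simp
  qed (simp add: exI [of _ 1])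
  ultimately show ?thesis by auto
qed

text \<open>Since \<open>mat_inv\<close> applies \<open>the\<close> to an option, the case
  \<open>None\<close> has to be excluded first; a nonzero determinant makes the matrix a unit of the
  matrix ring, which does so.\<close>

lemma mat_inv_hermitian_pos_def:
  assumes hA: "hermitian_pos_def n A"
  shows "mat_inv A \<in> carrier_mat n n" "A * mat_inv A = 1\<^sub>m n" "mat_inv A * A = 1\<^sub>m n"
proof -
  note A = hermitian_pos_defD(1) [OF hA]
  have "Determinant.det A \<noteq> 0" using det_hermitian_pos_def [OF hA] by auto
  then have "A \<in> Units (ring_mat TYPE(complex) n ())" by (rule det_non_zero_imp_unit [OF A])
  then obtain B where "mat_inverse A = Some B"
    using mat_inverse(1) [OF A, of "()"] by (cases "mat_inverse A") auto
  then have "mat_inverse A = Some (mat_inv A)" by (simp add: mat_inv_def)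
  from mat_inverse(2) [OF A this]
  show "mat_inv A \<in> carrier_mat n n" "A * mat_inv A = 1\<^sub>m n" "mat_inv A * A = 1\<^sub>m n"
    by auto
qed

lemma mat_inv_eqI:
  assumes hA: "hermitian_pos_def n A" and B: "B \<in> carrier_mat n n" and BA: "B * A = 1\<^sub>m n"
  shows "mat_inv A = B"
proof -
  note A = hermitian_pos_defD(1) [OF hA] and iA = mat_inv_hermitian_pos_def [OF hA]
  have "B = B * (A * mat_inv A)" using B iA by simp
  also have "\<dots> = B * A * mat_inv A" using A B iA by simp
  finally show ?thesis using BA iA by simp
qed

lemma mat_adjoint_one: "mat_adjoint (1\<^sub>m n :: complex mat) = 1\<^sub>m n"
proof (rule eq_matI)
  show "mat_adjoint (1\<^sub>m n :: complex mat) $$ (i, j) = 1\<^sub>m n $$ (i, j)"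
    if "i < dim_row (1\<^sub>m n :: complex mat)" "j < dim_col (1\<^sub>m n :: complex mat)" for i j
    using that index_mat_adjoint [of "1\<^sub>m n :: complex mat" n n i j] by auto
qed (auto simp: mat_adjoint_def)

text \<open>The adjoint of the inverse is again a left inverse of \<open>A\<close>, hence equal to
  the inverse. For positivity, substitute w for the inverse applied to v: the form of the inverse at
  v is the form of \<open>A\<close> at w.\<close>

lemma hermitian_pos_def_mat_inv:
  assumes hA: "hermitian_pos_def n A"
  shows "hermitian_pos_def n (mat_inv A)"
proof -
  note A = hermitian_pos_defD(1) [OF hA] and iA = mat_inv_hermitian_pos_def [OF hA]
  let ?B = "mat_inv A"
  have "mat_adjoint ?B * A = mat_adjoint (A * ?B)"
    using hermitian_pos_defD(2) [OF hA] mat_adjoint_mult [OF A iA(1)] by simp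
  also have "\<dots> = 1\<^sub>m n" by (simp add: iA mat_adjoint_one)
  finally have adj: "mat_adjoint ?B = ?B"
    using mat_inv_eqI [OF hA mat_adjoint_carrier [OF iA(1)]] by simp
  have "0 < Re ((?B *\<^sub>v v) \<bullet>c v)" if v: "v \<in> carrier_vec n" "v \<noteq> 0\<^sub>v n" for v
  proof -
    let ?w = "?B *\<^sub>v v"
    have w: "?w \<in> carrier_vec n" using iA(1) v(1) by simp
    have Aw: "A *\<^sub>v ?w = v"
      using assoc_mult_mat_vec [OF A iA(1) v(1)] iA v by simp
    have "A *\<^sub>v 0\<^sub>v n = 0\<^sub>v n" using A by (intro eq_vecI) auto
    then have "?w \<noteq> 0\<^sub>v n" using Aw v(2) by metis
    then have "0 < Re ((A *\<^sub>v ?w) \<bullet>c ?w)" by (rule hermitian_pos_defD(3) [OF hA w])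
    also have "(A *\<^sub>v ?w) \<bullet>c ?w = ?w \<bullet>c v"
      using hermitian_pos_def_selfadjoint [OF hA w w] by (simp add: Aw)
    finally show ?thesis .
  qed
  then show ?thesis using iA(1) adj by (simp add: hermitian_pos_def_def)
qed

section \<open>Sesquilinear algebra and completing the square\<close>

lemma mult_add_mat_vec:
  fixes A B :: "complex mat"
  assumes "A \<in> carrier_mat nr nc" "B \<in> carrier_mat nr nc" "v \<in> carrier_vec nc"
  shows "(A + B) *\<^sub>v v = A *\<^sub>v v + B *\<^sub>v v"
  using assms by (intro eq_vecI) (auto simp: add_scalar_prod_distrib [of _ nc])

lemma cscalar_prod_add_left:
  fixes u v w :: "complex Matrix.vec"
  assumes "u \<in> carrier_vec n" "v \<in> carrier_vec n" "w \<in> carrier_vec n"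
  shows "(u + v) \<bullet>c w = u \<bullet>c w + v \<bullet>c w"
  using assms by (simp add: cscalar_prod_sum [of _ n] distrib_right sum.distrib)

lemma cscalar_prod_minus_left:
  fixes u v w :: "complex Matrix.vec"
  assumes "u \<in> carrier_vec n" "v \<in> carrier_vec n" "w \<in> carrier_vec n"
  shows "(u - v) \<bullet>c w = u \<bullet>c w - v \<bullet>c w"
  using assms by (simp add: cscalar_prod_sum [of _ n] left_diff_distrib sum_subtractf)

lemma cscalar_prod_add_right:
  fixes u v w :: "complex Matrix.vec"
  assumes "u \<in> carrier_vec n" "v \<in> carrier_vec n" "w \<in> carrier_vec n"
  shows "w \<bullet>c (u + v) = w \<bullet>c u + w \<bullet>c v"
  using assms by (simp add: cscalar_prod_sum [of _ n] distrib_left sum.distrib)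

lemma cscalar_prod_smult_left:
  fixes u w :: "complex Matrix.vec"
  assumes "u \<in> carrier_vec n" "w \<in> carrier_vec n"
  shows "(c \<cdot>\<^sub>v u) \<bullet>c w = c * (u \<bullet>c w)"
  using assms by (simp add: cscalar_prod_sum [of _ n] sum_distrib_left mult_ac)

lemma cscalar_prod_smult_right:
  fixes u w :: "complex Matrix.vec"
  assumes "u \<in> carrier_vec n" "w \<in> carrier_vec n"
  shows "w \<bullet>c (c \<cdot>\<^sub>v u) = cnj c * (w \<bullet>c u)"
  using assms by (simp add: cscalar_prod_sum [of _ n] sum_distrib_left mult_ac)

lemma triple_mult_mat_vec:
  fixes A B C :: "complex mat"
  assumes A: "A \<in> carrier_mat n r" and B: "B \<in> carrier_mat r r" and C: "C \<in> carrier_mat r n"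
    and v: "v \<in> carrier_vec n"
  shows "(A * B * C) *\<^sub>v v = A *\<^sub>v (B *\<^sub>v (C *\<^sub>v v))"
  using assoc_mult_mat_vec [OF mult_carrier_mat [OF A B] C v]
    assoc_mult_mat_vec [OF A B mult_mat_vec_carrier [OF C v]] by simp

text \<open>This is the posterior precision matrix. The Gram part is the form of \<open>S\<close> at
  X v and is only known to be nonnegative, as \<open>X\<close> may have a kernel; strictness comes
  from the prior precision \<open>D\<close>.\<close>

lemma hermitian_pos_def_gram_add:
  assumes S: "hermitian_pos_def r S" and D: "hermitian_pos_def n D" and X: "X \<in> carrier_mat r n"
  shows "hermitian_pos_def n (mat_adjoint X * S * X + D)"
proof -
  note Sc = hermitian_pos_defD(1) [OF S] and Dc = hermitian_pos_defD(1) [OF D]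
  note X' = mat_adjoint_carrier [OF X]
  have G: "mat_adjoint X * S * X \<in> carrier_mat n n" using X X' Sc by auto
  have "mat_adjoint (mat_adjoint X * S * X) = mat_adjoint X * (mat_adjoint S * X)"
    by (simp only: mat_adjoint_mult [OF mult_carrier_mat [OF X' Sc] X] mat_adjoint_mult [OF X' Sc]
        mat_adjoint_adjoint [OF X])
  also have "\<dots> = mat_adjoint X * S * X"
    by (simp only: hermitian_pos_defD(2) [OF S] assoc_mult_mat [OF X' Sc X])
  finally have "mat_adjoint (mat_adjoint X * S * X + D) = mat_adjoint X * S * X + D"
    using mat_adjoint_add [OF G Dc] hermitian_pos_defD(2) [OF D] by simp
  moreover have "0 < Re (((mat_adjoint X * S * X + D) *\<^sub>v v) \<bullet>c v)"
    if v: "v \<in> carrier_vec n" "v \<noteq> 0\<^sub>v n" for v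
  proof -
    have Xv: "X *\<^sub>v v \<in> carrier_vec r" using X v by simp
    have "(mat_adjoint X * S * X) *\<^sub>v v = mat_adjoint X *\<^sub>v (S *\<^sub>v (X *\<^sub>v v))"
      by (rule triple_mult_mat_vec [OF X' Sc X v(1)])
    then have "((mat_adjoint X * S * X) *\<^sub>v v) \<bullet>c v = (S *\<^sub>v (X *\<^sub>v v)) \<bullet>c (X *\<^sub>v v)"
      using cscalar_prod_adjoint [OF X', of "S *\<^sub>v (X *\<^sub>v v)" v] Sc Xv v
      by (simp add: mat_adjoint_adjoint [OF X])
    then have "((mat_adjoint X * S * X + D) *\<^sub>v v) \<bullet>c v
        = (S *\<^sub>v (X *\<^sub>v v)) \<bullet>c (X *\<^sub>v v) + (D *\<^sub>v v) \<bullet>c v"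
      using G Dc v by (simp add: mult_add_mat_vec [OF G Dc] cscalar_prod_add_left [of _ n])
    then show ?thesis
      using hermitian_pos_def_nonneg [OF S Xv] hermitian_pos_defD(3) [OF D v] by simp
  qed
  ultimately show ?thesis using G Dc by (simp add: hermitian_pos_def_def)
qed

text \<open>By self-adjointness the two cross terms are conjugates of each other, so their sum is
  twice a real part. The conjugate falls on \<open>t\<close> because \<open>\<bullet>c\<close>
  conjugates its second argument.\<close>

lemma quadratic_form_shift:
  assumes A: "hermitian_pos_def n A" and v: "v \<in> carrier_vec n" and u: "u \<in> carrier_vec n"
  shows "Re ((A *\<^sub>v (v + t \<cdot>\<^sub>v u)) \<bullet>c (v + t \<cdot>\<^sub>v u))
    = Re ((A *\<^sub>v v) \<bullet>c v) + 2 * Re (cnj t * ((A *\<^sub>v v) \<bullet>c u))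
      + (cmod t)\<^sup>2 * Re ((A *\<^sub>v u) \<bullet>c u)"
proof -
  note Ac = hermitian_pos_defD(1) [OF A]
  have c: "A *\<^sub>v v \<in> carrier_vec n" "A *\<^sub>v u \<in> carrier_vec n" "t \<cdot>\<^sub>v u \<in> carrier_vec n"
    "t \<cdot>\<^sub>v (A *\<^sub>v u) \<in> carrier_vec n"
    using Ac u v by auto
  have "A *\<^sub>v (v + t \<cdot>\<^sub>v u) = A *\<^sub>v v + t \<cdot>\<^sub>v (A *\<^sub>v u)"
    using Ac u v by (simp add: mult_add_distrib_mat_vec [of _ n n] mult_mat_vec [of _ n n])
  then have "(A *\<^sub>v (v + t \<cdot>\<^sub>v u)) \<bullet>c (v + t \<cdot>\<^sub>v u) = (A *\<^sub>v v) \<bullet>c v + cnj t * ((A *\<^sub>v v) \<bullet>c u)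
      + t * ((A *\<^sub>v u) \<bullet>c v) + t * cnj t * ((A *\<^sub>v u) \<bullet>c u)"
    using u v c by (simp add: cscalar_prod_add_left [of _ n] cscalar_prod_add_right [of _ n]
        cscalar_prod_smult_left [of _ n] cscalar_prod_smult_right [of _ n] algebra_simps)
  also have "(A *\<^sub>v u) \<bullet>c v = cnj ((A *\<^sub>v v) \<bullet>c u)"
    using hermitian_pos_def_selfadjoint [OF A u v] cscalar_prod_commute [OF c(1) u] by simp
  also have "t * cnj t = complex_of_real ((cmod t)\<^sup>2)"
    by (rule complex_norm_square [symmetric])
  finally show ?thesis
    by simp
qed

text \<open>The direction \<open>u\<close> is a multiple of a column of the inverse precision, so
  the precision maps it to the unit vector e_p divided by \<open>s\<close>. Pairing with it
  therefore sees only the \<open>p\<close>-th entry. The linear term in \<open>t\<close> vanishes as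
  soon as \<open>a\<close> agrees with the posterior mean in that one entry, and the quadratic
  coefficient is 1/s because \<open>u\<close> has \<open>p\<close>-th entry 1.\<close>

lemma posterior_energy_shift:
  assumes S: "hermitian_pos_def r S" and D: "hermitian_pos_def n D" and X: "X \<in> carrier_mat r n"
    and y: "y \<in> carrier_vec r" and a: "a \<in> carrier_vec n" and p: "p < n"
    and \<Sigma>: "\<Sigma> = mat_inv (mat_adjoint X * S * X + D)"
    and s: "\<Sigma> $$ (p, p) = complex_of_real s" "s \<noteq> 0"
    and u: "u = complex_of_real (1 / s) \<cdot>\<^sub>v Matrix.col \<Sigma> p"
    and ap: "a $ p = (\<Sigma> *\<^sub>v (mat_adjoint X *\<^sub>v (S *\<^sub>v y))) $ p"
  shows "Re ((S *\<^sub>v (y - X *\<^sub>v (a + t \<cdot>\<^sub>v u))) \<bullet>c (y - X *\<^sub>v (a + t \<cdot>\<^sub>v u)))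
        + Re ((D *\<^sub>v (a + t \<cdot>\<^sub>v u)) \<bullet>c (a + t \<cdot>\<^sub>v u))
    = Re ((S *\<^sub>v (y - X *\<^sub>v a)) \<bullet>c (y - X *\<^sub>v a)) + Re ((D *\<^sub>v a) \<bullet>c a) + (cmod t)\<^sup>2 / s"
proof -
  note Sc = hermitian_pos_defD(1) [OF S] and Dc = hermitian_pos_defD(1) [OF D]
  note X' = mat_adjoint_carrier [OF X]
  define P where "P = mat_adjoint X * S * X + D"
  have hP: "hermitian_pos_def n P" unfolding P_def by (rule hermitian_pos_def_gram_add [OF S D X])
  note Pc = hermitian_pos_defD(1) [OF hP]
  note i\<Sigma> = mat_inv_hermitian_pos_def [OF hP, folded P_def \<Sigma> [folded P_def]]
  define b where "b = mat_adjoint X *\<^sub>v (S *\<^sub>v y)"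
  define \<mu> where "\<mu> = \<Sigma> *\<^sub>v b"
  define w where "w = y - X *\<^sub>v a"
  have b: "b \<in> carrier_vec n" unfolding b_def using X' Sc y by simp
  have \<mu>: "\<mu> \<in> carrier_vec n" unfolding \<mu>_def using i\<Sigma> b by simp
  have col: "Matrix.col \<Sigma> p \<in> carrier_vec n" using i\<Sigma>(1) p by (intro carrier_vecI) auto
  have uc: "u \<in> carrier_vec n" unfolding u using col by simp
  have w: "w \<in> carrier_vec r" unfolding w_def using X a y by simp
  have Xu: "X *\<^sub>v u \<in> carrier_vec r" using X uc by simp
  have P\<mu>: "P *\<^sub>v \<mu> = b"
    unfolding \<mu>_def using assoc_mult_mat_vec [OF Pc i\<Sigma>(1) b] i\<Sigma> b by simp
  have Pu: "P *\<^sub>v u = complex_of_real (1 / s) \<cdot>\<^sub>v unit_vec n p"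
  proof -
    have "P *\<^sub>v Matrix.col \<Sigma> p = Matrix.col (P * \<Sigma>) p"
      using Pc i\<Sigma>(1) p by (intro eq_vecI) auto
    also have "\<dots> = unit_vec n p" using i\<Sigma>(2) p by simp
    finally show ?thesis unfolding u
      by (simp only: mult_mat_vec [OF Pc col])
  qed
  have Pv: "P *\<^sub>v v = mat_adjoint X *\<^sub>v (S *\<^sub>v (X *\<^sub>v v)) + D *\<^sub>v v" if v: "v \<in> carrier_vec n" for v
  proof -
    have "mat_adjoint X * S * X \<in> carrier_mat n n" using X X' Sc by auto
    then show ?thesis
      unfolding P_def by (simp only: mult_add_mat_vec [OF _ Dc v] triple_mult_mat_vec [OF X' Sc X v])
  qed
  have adj: "(mat_adjoint X *\<^sub>v z) \<bullet>c u = z \<bullet>c (X *\<^sub>v u)" if "z \<in> carrier_vec r" for z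
    using cscalar_prod_adjoint [OF X' that uc] by (simp add: mat_adjoint_adjoint [OF X])
  have unit: "z \<bullet>c (complex_of_real (1 / s) \<cdot>\<^sub>v unit_vec n p) = z $ p / s"
    if "z \<in> carrier_vec n" for z
    using that p by (simp add: cscalar_prod_sum [of _ n] unit_vec_def if_distrib
        sum.delta' cong: if_cong)
  have up: "u $ p = 1" using i\<Sigma>(1) p s unfolding u by simp
  \<comment> \<open>The difference of the two sides is the pairing of P a - b = P (a - \<mu>) with
    \<open>u\<close>. Moving \<open>P\<close> over to \<open>u\<close> leaves the
    \<open>p\<close>-th entry of a - \<mu> divided by \<open>s\<close>, which is 0 by
    \<open>ap\<close>.\<close>
  have cross: "(D *\<^sub>v a) \<bullet>c u = (S *\<^sub>v w) \<bullet>c (X *\<^sub>v u)"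
  proof -
    have Xa: "X *\<^sub>v a \<in> carrier_vec r" "S *\<^sub>v (X *\<^sub>v a) \<in> carrier_vec r" "S *\<^sub>v y \<in> carrier_vec r"
      using X Sc a y by auto
    have "(P *\<^sub>v a - b) \<bullet>c u = (P *\<^sub>v (a - \<mu>)) \<bullet>c u"
      using a \<mu> Pc by (simp add: P\<mu> mult_minus_distrib_mat_vec [OF Pc])
    also have "\<dots> = (a - \<mu>) \<bullet>c (P *\<^sub>v u)"
      using a \<mu> uc by (intro hermitian_pos_def_selfadjoint [OF hP]) auto
    also have "\<dots> = (a - \<mu>) $ p / s"
      unfolding Pu using a \<mu> by (intro unit) auto
    also have "\<dots> = 0"
    proof -
      have "(a - \<mu>) $ p = a $ p - \<mu> $ p" using \<mu> p by simp
      also have "a $ p = \<mu> $ p" using ap by (simp add: \<mu>_def b_def)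
      finally show ?thesis by simp
    qed
    finally have "(P *\<^sub>v a) \<bullet>c u - b \<bullet>c u = 0"
      using Pc a b uc by (simp add: cscalar_prod_minus_left [of _ n])
    moreover have "(P *\<^sub>v a) \<bullet>c u = (S *\<^sub>v (X *\<^sub>v a)) \<bullet>c (X *\<^sub>v u) + (D *\<^sub>v a) \<bullet>c u"
      using X' Xa Dc a uc by (simp add: Pv [OF a] cscalar_prod_add_left [of _ n] adj)
    moreover have "b \<bullet>c u = (S *\<^sub>v y) \<bullet>c (X *\<^sub>v u)"
      unfolding b_def using Xa by (simp add: adj)
    moreover have "(S *\<^sub>v w) \<bullet>c (X *\<^sub>v u) = (S *\<^sub>v y) \<bullet>c (X *\<^sub>v u) - (S *\<^sub>v (X *\<^sub>v a)) \<bullet>c (X *\<^sub>v u)"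
      unfolding w_def using Xa Xu Sc y
      by (simp add: mult_minus_distrib_mat_vec [OF Sc] cscalar_prod_minus_left [of _ r])
    ultimately show ?thesis by (metis add_diff_cancel_left' eq_iff_diff_eq_0)
  qed
  have square: "(S *\<^sub>v (X *\<^sub>v u)) \<bullet>c (X *\<^sub>v u) + (D *\<^sub>v u) \<bullet>c u = 1 / s"
  proof -
    have "(S *\<^sub>v (X *\<^sub>v u)) \<bullet>c (X *\<^sub>v u) + (D *\<^sub>v u) \<bullet>c u = (P *\<^sub>v u) \<bullet>c u"
      using X' Xu Sc Dc uc by (simp add: Pv [OF uc] cscalar_prod_add_left [of _ n] adj)
    also have "\<dots> = cnj (u \<bullet>c (P *\<^sub>v u))"
      using Pc uc by (intro cscalar_prod_commute) auto
    also have "\<dots> = 1 / s"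
      unfolding Pu by (subst unit [OF uc]) (simp add: up)
    finally show ?thesis .
  qed
  \<comment> \<open>The residual moves by \<open>- t\<close>, so its linear term has the opposite
    sign to that of the prior term, and the two cancel by \<open>cross\<close>.\<close>
  have "y - X *\<^sub>v (a + t \<cdot>\<^sub>v u) = w + (- t) \<cdot>\<^sub>v (X *\<^sub>v u)"
    unfolding w_def using X a y uc
    by (simp add: mult_add_distrib_mat_vec [of _ r n] mult_mat_vec [of _ r n])
      (intro eq_vecI, auto)
  then have "Re ((S *\<^sub>v (y - X *\<^sub>v (a + t \<cdot>\<^sub>v u))) \<bullet>c (y - X *\<^sub>v (a + t \<cdot>\<^sub>v u)))
    = Re ((S *\<^sub>v w) \<bullet>c w) - 2 * Re (cnj t * ((S *\<^sub>v w) \<bullet>c (X *\<^sub>v u)))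
      + (cmod t)\<^sup>2 * Re ((S *\<^sub>v (X *\<^sub>v u)) \<bullet>c (X *\<^sub>v u))"
    by (simp only: quadratic_form_shift [OF S w Xu, of "- t"]) simp
  moreover have "Re ((S *\<^sub>v (X *\<^sub>v u)) \<bullet>c (X *\<^sub>v u)) + Re ((D *\<^sub>v u) \<bullet>c u) = 1 / s"
    using arg_cong [where f = Re, OF square] by simp
  then have "(cmod t)\<^sup>2 * Re ((S *\<^sub>v (X *\<^sub>v u)) \<bullet>c (X *\<^sub>v u))
      + (cmod t)\<^sup>2 * Re ((D *\<^sub>v u) \<bullet>c u) = (cmod t)\<^sup>2 / s"
    by (simp only: distrib_left [symmetric]) simp
  ultimately show ?thesis
    unfolding quadratic_form_shift [OF D a uc] cross w_def [symmetric] by linarith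
qed

lemma hermitian_pos_def_mat_diag:
  assumes f: "\<And>i. i < n \<Longrightarrow> 0 < f i"
  shows "hermitian_pos_def n (mat_diag n (\<lambda>i. complex_of_real (f i)))"
    and "v \<in> carrier_vec n \<Longrightarrow> (mat_diag n (\<lambda>i. complex_of_real (f i)) *\<^sub>v v) \<bullet>c v
      = complex_of_real (\<Sum>i<n. f i * (cmod (v $ i))\<^sup>2)"
    and "mat_inv (mat_diag n (\<lambda>i. complex_of_real (f i))) = mat_diag n (\<lambda>i. complex_of_real (1 / f i))"
proof -
  let ?A = "mat_diag n (\<lambda>i. complex_of_real (f i))"
  have form: "(?A *\<^sub>v v) \<bullet>c v = complex_of_real (\<Sum>i<n. f i * (cmod (v $ i))\<^sup>2)"
    if v: "v \<in> carrier_vec n" for v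
  proof -
    have "(?A *\<^sub>v v) $ i = f i * v $ i" if "i < n" for i
      using that v by (simp add: mat_diag_def scalar_prod_def if_distrib [of "\<lambda>z. z * _"]
          sum.delta cong: if_cong)
    then have "(?A *\<^sub>v v) \<bullet>c v = (\<Sum>i<n. complex_of_real (f i) * (v $ i * cnj (v $ i)))"
      unfolding cscalar_prod_sum [OF v] by (intro sum.cong) (simp_all add: mult.assoc)
    then show ?thesis
      by (simp only: complex_norm_square of_real_sum of_real_mult)
  qed
  then show "v \<in> carrier_vec n \<Longrightarrow> (?A *\<^sub>v v) \<bullet>c v = complex_of_real (\<Sum>i<n. f i * (cmod (v $ i))\<^sup>2)" .
  have "mat_adjoint ?A = ?A"
  proof (rule eq_matI)
    have "mat_adjoint ?A \<in> carrier_mat n n" by (rule mat_adjoint_carrier) simp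
    then show "dim_row (mat_adjoint ?A) = dim_row ?A" "dim_col (mat_adjoint ?A) = dim_col ?A"
      by (auto simp: mat_diag_def)
    fix i j assume "i < dim_row ?A" "j < dim_col ?A"
    then show "mat_adjoint ?A $$ (i, j) = ?A $$ (i, j)"
      using index_mat_adjoint [OF mat_diag_dim, of i n j] by (auto simp: mat_diag_def)
  qed
  moreover have "0 < Re ((?A *\<^sub>v v) \<bullet>c v)" if v: "v \<in> carrier_vec n" "v \<noteq> 0\<^sub>v n" for v
  proof -
    obtain i where "i < n" "v $ i \<noteq> 0" using v by (auto simp: vec_eq_iff)
    then have "0 < (\<Sum>i<n. f i * (cmod (v $ i))\<^sup>2)"
      using f by (intro sum_pos2 [of _ i]) (auto simp: less_imp_le)
    then show ?thesis by (simp add: form [OF v(1)])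
  qed
  ultimately show h: "hermitian_pos_def n ?A" by (simp add: hermitian_pos_def_def)
  show "mat_inv ?A = mat_diag n (\<lambda>i. complex_of_real (1 / f i))"
  proof (rule mat_inv_eqI [OF h])
    have "f i \<noteq> 0" if "i < n" for i using f [OF that] by simp
    then show "mat_diag n (\<lambda>i. complex_of_real (1 / f i)) * ?A = 1\<^sub>m n"
      unfolding mat_diag_diag by (auto simp: mat_diag_def intro!: eq_matI)
  qed simp
qed

text \<open>The form at a unit vector is the diagonal entry. Applied to the posterior covariance,
  this makes its diagonal entries usable as variances.\<close>

lemma hermitian_pos_def_diag_entry:
  assumes A: "hermitian_pos_def n A" and p: "p < n"
  shows "A $$ (p, p) = complex_of_real (Re (A $$ (p, p)))" and "0 < Re (A $$ (p, p))"
proof -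
  note Ac = hermitian_pos_defD(1) [OF A]
  have "A $$ (p, p) = cnj (A $$ (p, p))"
    using index_mat_adjoint [OF Ac p p] hermitian_pos_defD(2) [OF A] by simp
  then show "A $$ (p, p) = complex_of_real (Re (A $$ (p, p)))"
    by (simp add: complex_eq_iff)
  have e: "unit_vec n p \<in> carrier_vec n" "unit_vec n p \<noteq> (0\<^sub>v n :: complex Matrix.vec)"
    using p by auto
  have "(A *\<^sub>v unit_vec n p) \<bullet>c unit_vec n p = A $$ (p, p)"
    using Ac p unfolding cscalar_prod_sum [OF e(1)]
    by (simp add: unit_vec_def scalar_prod_def if_distrib sum.delta' cong: if_cong)
  then show "0 < Re (A $$ (p, p))" using hermitian_pos_defD(3) [OF A e] by simp
qed

section \<open>Channel indices and the prior\<close>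

lemma sum_atLeastLessThan_offset:
  "(\<Sum>j = a..<a + k. g j) = (\<Sum>j<k. g (a + j) :: 'a :: comm_monoid_add)" for a k :: nat
  by (subst sum.atLeastLessThan_shift_0) (simp add: lessThan_atLeast0)

lemma sum_blocks:
  "(\<Sum>i<a. \<Sum>j<b. g (i * b + j)) = (\<Sum>q<a * b. g q :: 'a :: comm_monoid_add)" for a b :: nat
proof -
  have "(\<Sum>q<a * b. g q) = (\<Sum>i<a. sum g {i * b..<i * b + b})"
    by (rule sum.nat_group [symmetric])
  also have "\<dots> = (\<Sum>i<a. \<Sum>j<b. g (i * b + j))"
    by (simp only: sum_atLeastLessThan_offset)
  finally show ?thesis by simp
qed

lemma channel_index_less:
  fixes m n j :: nat
  assumes "m < M" "n < N" "j < R"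
  shows "m * N * R + n * R + j < N * M * R"
proof -
  have "n * R + j < N * R"
    using mult_le_mono1 [of "Suc n" N R] assms by simp
  moreover have "m * (N * R) + N * R \<le> M * (N * R)"
    using mult_le_mono1 [of "Suc m" M "N * R"] assms by simp
  ultimately show ?thesis by (simp add: mult_ac)
qed

lemma block_less:
  fixes i j d R :: nat
  assumes "d dvd R" "i < R div d" "j < (i + 1) * d"
  shows "j < R"
proof -
  have "(i + 1) * d \<le> R div d * d" using assms by (intro mult_le_mono1) simp
  then show ?thesis using assms by simp
qed

text \<open>A row index is read in mixed radix as q = (m N + n) R + j, and j again as a group number
  times \<open>d\<close> plus an offset. The group of row q is thus \<open>q mod R div d\<close>,
  and the nested sums visit every row exactly once.\<close>

lemma sum_channel_groups:
  fixes g :: "nat \<Rightarrow> nat \<Rightarrow> 'a :: comm_monoid_add"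
  assumes d: "0 < d" "d dvd R"
  shows "(\<Sum>n<N. \<Sum>m<M. \<Sum>i<R div d. \<Sum>j = i * d..<(i + 1) * d. g i (m * N * R + n * R + j))
    = (\<Sum>q<N * M * R. g (q mod R div d) q)"
proof -
  have "(\<Sum>i<R div d. \<Sum>j = i * d..<(i + 1) * d. g i (c * R + j))
      = (\<Sum>j<R. g ((c * R + j) mod R div d) (c * R + j))" for c
  proof -
    have *: "(i + 1) * d = i * d + d" for i by simp
    have "(\<Sum>i<R div d. \<Sum>j = i * d..<(i + 1) * d. g i (c * R + j))
        = (\<Sum>i<R div d. \<Sum>j<d. g ((i * d + j) div d) (c * R + (i * d + j)))"
      unfolding * sum_atLeastLessThan_offset using d by simp
    also have "\<dots> = (\<Sum>j<R. g (j div d) (c * R + j))"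
      using d sum_blocks [of "\<lambda>j. g (j div d) (c * R + j)" d "R div d"] by simp
    finally show ?thesis by simp
  qed
  then have "(\<Sum>n<N. \<Sum>m<M. \<Sum>i<R div d. \<Sum>j = i * d..<(i + 1) * d. g i (m * N * R + n * R + j))
      = (\<Sum>n<N. \<Sum>m<M. \<Sum>j<R. g (((m * N + n) * R + j) mod R div d) ((m * N + n) * R + j))"
    by (simp only: distrib_right [symmetric])
  \<comment> \<open>In the stacking \<open>n\<close> varies faster than \<open>m\<close>, so
    \<open>m\<close> has to be outermost before the blocks can be merged.\<close>
  also have "\<dots> = (\<Sum>m<M. \<Sum>n<N. \<Sum>j<R. g (((m * N + n) * R + j) mod R div d) ((m * N + n) * R + j))"
    by (rule sum.swap)
  also have "\<dots> = (\<Sum>c<M * N. \<Sum>j<R. g ((c * R + j) mod R div d) (c * R + j))"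
    by (rule sum_blocks)
  also have "\<dots> = (\<Sum>q<M * N * R. g (q mod R div d) q)"
    by (rule sum_blocks)
  finally show ?thesis by (simp only: mult.commute [of M N])
qed

text \<open>The Kronecker factors are stripped from the inside outwards. At each level two indices
  are equal exactly if their quotients and their remainders are, so a product with an identity
  factor stays diagonal.\<close>

lemma Psi_JG_eq_diag:
  assumes d: "0 < d" "d dvd R"
  shows "Psi_JG N M R d \<psi> = mat_diag (N * M * R) (\<lambda>q. complex_of_real (\<psi> $ (q mod R div d)))"
proof -
  let ?diag = "mat_diag (N * M * R) (\<lambda>q. complex_of_real (\<psi> $ (q mod R div d)))"
  define D where "D = mat_diag (R div d) (\<lambda>i. complex_of_real (\<psi> $ i)) \<otimes>\<^sub>K 1\<^sub>m d"
  define B where "B = 1\<^sub>m N \<otimes>\<^sub>K D"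
  have Psi: "Psi_JG N M R d \<psi> = 1\<^sub>m M \<otimes>\<^sub>K B" by (simp add: Psi_JG_def B_def D_def)
  have R: "R div d * d = R" using d by simp
  have dimD: "dim_row D = R" "dim_col D = R" by (simp_all add: D_def kron_def mat_diag_def R)
  then have dimB: "dim_row B = N * R" "dim_col B = N * R"
    by (simp_all add: B_def kron_def)
  have "Psi_JG N M R d \<psi> $$ (p, q) = ?diag $$ (p, q)"
    if pq: "p < M * (N * R)" "q < M * (N * R)" for p q
  proof -
    have pos: "0 < N * R" "0 < R" "0 < N" using pq by (auto intro: gr0I)
    have lt: "x div (N * R) < M" "x mod (N * R) < N * R" "x mod (N * R) div R < N" "x mod R < R"
        "x mod R div d < R div d" "x mod (N * R) mod R = x mod R" "x mod R < R div d * d"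
        if "x < M * (N * R)" for x
      using that pos d
      by (auto simp: less_mult_imp_div_less mod_mod_cancel R)
    note ltp = lt [OF pq(1)] and ltq = lt [OF pq(2)]
    have "p mod R = q mod R \<longleftrightarrow> p mod R div d = q mod R div d \<and> p mod R mod d = q mod R mod d"
      by (metis div_mult_mod_eq)
    then have eqD: "D $$ (p mod R, q mod R) = (if p mod R = q mod R then complex_of_real (\<psi> $ (q mod R div d)) else 0)"
      using ltp ltq d by (auto simp: D_def kron_def mat_diag_def)
    have "p mod (N * R) = q mod (N * R) \<longleftrightarrow>
        p mod (N * R) div R = q mod (N * R) div R \<and> p mod R = q mod R"
      using ltp(6) ltq(6) by (metis div_mult_mod_eq)
    then have eqB: "B $$ (p mod (N * R), q mod (N * R))
        = (if p mod (N * R) = q mod (N * R) then complex_of_real (\<psi> $ (q mod R div d)) else 0)"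
      using ltp ltq eqD by (auto simp: B_def kron_def dimD)
    have "p = q \<longleftrightarrow> p div (N * R) = q div (N * R) \<and> p mod (N * R) = q mod (N * R)"
      by (metis div_mult_mod_eq)
    then show ?thesis
      using ltp ltq eqB pq by (auto simp: Psi kron_def dimB mat_diag_def mult.left_commute mult.commute)
  qed
  then show ?thesis
    by (intro eq_matI) (auto simp: Psi kron_def dimB mat_diag_def mult_ac)
qed

text \<open>Separates the normalizing constant, which depends on the hyperparameters alone, from the
  exponential of the energy, so that the logarithm splits later.\<close>

lemma prior_density_eq:
  assumes d: "d dvd R"
  shows "prior_density N M R K d \<psi> H = (\<Prod>i<R div d. 1 / (pi * \<psi> $ i) ^ d) ^ (N * M * K) *
    exp (- (\<Sum>n<N. \<Sum>m<M. \<Sum>k<K. \<Sum>i<R div d. 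
      (\<Sum>j = i * d..<(i + 1) * d. (cmod (H $$ (m * N * R + n * R + j, k)))\<^sup>2) / \<psi> $ i))"
proof -
  \<comment> \<open>\<open>channel_vec\<close> has length \<open>R\<close>, so its entries may be
    unfolded only because divisibility keeps each group inside this length.\<close>
  have "(\<Sum>j = i * d..<(i + 1) * d. (cmod (channel_vec N R H n m k $ j))\<^sup>2)
      = (\<Sum>j = i * d..<(i + 1) * d. (cmod (H $$ (m * N * R + n * R + j, k)))\<^sup>2)"
    if "i < R div d" for i n m k
    using block_less [OF d that] by (intro sum.cong) (auto simp: channel_vec_def)
  then have "prior_density N M R K d \<psi> H = (\<Prod>n<N. \<Prod>m<M. \<Prod>k<K. \<Prod>i<R div d.
        1 / (pi * \<psi> $ i) ^ d *
        exp (- ((\<Sum>j = i * d..<(i + 1) * d. (cmod (H $$ (m * N * R + n * R + j, k)))\<^sup>2) / \<psi> $ i)))"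
    unfolding prior_density_def by (intro prod.cong refl) simp
  also have "\<dots> = (\<Prod>i<R div d. 1 / (pi * \<psi> $ i) ^ d) ^ (N * M * K) *
      (\<Prod>n<N. \<Prod>m<M. \<Prod>k<K. \<Prod>i<R div d.
        exp (- ((\<Sum>j = i * d..<(i + 1) * d. (cmod (H $$ (m * N * R + n * R + j, k)))\<^sup>2) / \<psi> $ i)))"
    by (simp only: prod.distrib prod_constant card_lessThan power_mult [symmetric] mult_ac)
  finally show ?thesis
    by (simp add: exp_sum flip: sum_negf)
qed

text \<open>Passes from the grouping by hyperparameter, as in the prior, to one diagonal quadratic
  form for each column, as in the posterior precision.\<close>

lemma sum_prior_energy:
  fixes h :: "nat \<Rightarrow> nat \<Rightarrow> real"
  assumes d: "0 < d" "d dvd R"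
  shows "(\<Sum>n<N. \<Sum>m<M. \<Sum>k<K. \<Sum>i<R div d.
      (\<Sum>j = i * d..<(i + 1) * d. h (m * N * R + n * R + j) k) / \<psi> $ i)
    = (\<Sum>k<K. \<Sum>q<N * M * R. h q k / \<psi> $ (q mod R div d))"
proof -
  have "(\<Sum>n<N. \<Sum>m<M. \<Sum>k<K. \<Sum>i<R div d.
      (\<Sum>j = i * d..<(i + 1) * d. h (m * N * R + n * R + j) k) / \<psi> $ i)
      = (\<Sum>n<N. \<Sum>m<M. \<Sum>i<R div d. \<Sum>j = i * d..<(i + 1) * d.
          \<Sum>k<K. h (m * N * R + n * R + j) k / \<psi> $ i)"
    by (simp only: sum_divide_distrib sum.swap [of _ _ "{..<K}"])
  also have "\<dots> = (\<Sum>q<N * M * R. \<Sum>k<K. h q k / \<psi> $ (q mod R div d))"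
    by (rule sum_channel_groups [OF d])
  also have "\<dots> = (\<Sum>k<K. \<Sum>q<N * M * R. h q k / \<psi> $ (q mod R div d))"
    by (rule sum.swap)
  finally show ?thesis .
qed

section \<open>Moments of the Gaussian posterior\<close>

text \<open>Over a finite measure this class contains the constants and is closed under linear
  combinations, and products f cnj(g) of its members are integrable. Second moments of the single
  entries thus control every quadratic expression in them.\<close>

definition square_integrable :: "'a measure \<Rightarrow> ('a \<Rightarrow> complex) \<Rightarrow> bool" where
  "square_integrable M f \<longleftrightarrow>
     f \<in> borel_measurable M \<and> integrable M (\<lambda>x. (cmod (f x))\<^sup>2)"

lemma square_integrable_add:
  assumes "square_integrable M f" "square_integrable M g"
  shows "square_integrable M (\<lambda>x. f x + g x)"
proof -
  have [measurable]: "f \<in> borel_measurable M" "g \<in> borel_measurable M"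
    and int: "integrable M (\<lambda>x. 2 * (cmod (f x))\<^sup>2 + 2 * (cmod (g x))\<^sup>2)"
    using assms by (auto simp: square_integrable_def)
  have "(cmod (a + b))\<^sup>2 \<le> 2 * (cmod a)\<^sup>2 + 2 * (cmod b)\<^sup>2" for a b
  proof -
    have "(cmod (a + b))\<^sup>2 \<le> (cmod a + cmod b)\<^sup>2"
      by (intro power_mono norm_triangle_ineq) simp
    also have "\<dots> \<le> 2 * (cmod a)\<^sup>2 + 2 * (cmod b)\<^sup>2"
      using sum_squares_bound [of "cmod a" "cmod b"] by (simp add: power2_sum)
    finally show ?thesis .
  qed
  then have "integrable M (\<lambda>x. (cmod (f x + g x))\<^sup>2)"
    by (intro Bochner_Integration.integrable_bound [OF int] AE_I2) auto
  then show ?thesis by (simp add: square_integrable_def)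
qed

lemma square_integrable_cmult:
  assumes "square_integrable M f"
  shows "square_integrable M (\<lambda>x. c * f x)"
  using assms by (auto simp: square_integrable_def norm_mult power_mult_distrib)

lemma (in finite_measure) square_integrable_const: "square_integrable M (\<lambda>_. c)"
  by (simp add: square_integrable_def)

lemma (in finite_measure) square_integrable_sum:
  assumes "\<And>i. i \<in> A \<Longrightarrow> square_integrable M (f i)"
  shows "square_integrable M (\<lambda>x. \<Sum>i\<in>A. f i x)"
  using assms
proof (induction A rule: infinite_finite_induct)
  case (insert a A)
  then show ?case using square_integrable_add [of M "f a" "\<lambda>x. \<Sum>i\<in>A. f i x"] by simp
qed (use square_integrable_const [of 0] in auto)

lemma measurable_cnj [measurable]: "cnj \<in> borel \<rightarrow>\<^sub>M borel"
  by (intro borel_measurable_continuous_onI continuous_intros)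

lemma square_integrable_mult_cnj:
  assumes "square_integrable M f" "square_integrable M g"
  shows "integrable M (\<lambda>x. f x * cnj (g x))"
proof -
  have [measurable]: "f \<in> borel_measurable M" "g \<in> borel_measurable M"
    and int: "integrable M (\<lambda>x. (cmod (f x))\<^sup>2 + (cmod (g x))\<^sup>2)"
    using assms by (auto simp: square_integrable_def)
  have "cmod a * cmod b \<le> (cmod a)\<^sup>2 + (cmod b)\<^sup>2" for a b
    using sum_squares_bound [of "cmod a" "cmod b"] zero_le_power2 [of "cmod a"] zero_le_power2 [of "cmod b"]
      mult_nonneg_nonneg [of "cmod a" "cmod b"] norm_ge_zero [of a] norm_ge_zero [of b] by linarith
  then show ?thesis
    by (intro Bochner_Integration.integrable_bound [OF int] AE_I2) (auto simp: norm_mult)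
qed

text \<open>With \<open>S\<close> the inverse noise covariance, this is the negative log-likelihood
  up to an additive constant.\<close>

definition obs_energy :: "complex mat \<Rightarrow> complex mat \<Rightarrow> complex mat \<Rightarrow> complex mat \<Rightarrow> real" where
  "obs_energy S X Y H = (\<Sum>k<dim_col Y.
     Re ((S *\<^sub>v (Matrix.col Y k - X *\<^sub>v Matrix.col H k)) \<bullet>c (Matrix.col Y k - X *\<^sub>v Matrix.col H k)))"

text \<open>Written as a polynomial in the entries of \<open>H\<close> and their conjugates, the
  energy inherits measurability and integrability from the entries.\<close>

lemma obs_energy_entries:
  assumes S: "S \<in> carrier_mat r r" and X: "X \<in> carrier_mat r n" and Y: "Y \<in> carrier_mat r K"
    and H: "H \<in> carrier_mat n K"
  shows "obs_energy S X Y H = (\<Sum>k<K. \<Sum>i<r. Re (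
     (\<Sum>j<r. S $$ (i, j) * (Y $$ (j, k) - (\<Sum>q<n. X $$ (j, q) * H $$ (q, k)))) *
       cnj (Y $$ (i, k) - (\<Sum>q<n. X $$ (i, q) * H $$ (q, k)))))"
proof -
  have "Re ((S *\<^sub>v (Matrix.col Y k - X *\<^sub>v Matrix.col H k)) \<bullet>c (Matrix.col Y k - X *\<^sub>v Matrix.col H k))
      = (\<Sum>i<r. Re ((\<Sum>j<r. S $$ (i, j) * (Y $$ (j, k) - (\<Sum>q<n. X $$ (j, q) * H $$ (q, k)))) *
          cnj (Y $$ (i, k) - (\<Sum>q<n. X $$ (i, q) * H $$ (q, k)))))" if k: "k < K" for k
  proof -
    let ?w = "Matrix.col Y k - X *\<^sub>v Matrix.col H k"
    have wc: "?w \<in> carrier_vec r" using X Y by (intro carrier_vecI) auto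
    have w: "?w $ i = Y $$ (i, k) - (\<Sum>q<n. X $$ (i, q) * H $$ (q, k))" if "i < r" for i
      using X Y H k that by (simp add: scalar_prod_def lessThan_atLeast0)
    have Sw: "(S *\<^sub>v ?w) $ i = (\<Sum>j<r. S $$ (i, j) * (Y $$ (j, k) - (\<Sum>q<n. X $$ (j, q) * H $$ (q, k))))"
      if i: "i < r" for i
    proof -
      have "(S *\<^sub>v ?w) $ i = (\<Sum>j<r. S $$ (i, j) * ?w $ j)"
        using S wc i by (simp add: scalar_prod_def lessThan_atLeast0 del: index_minus_vec)
      then show ?thesis by (simp add: w)
    qed
    show ?thesis
      unfolding cscalar_prod_sum [OF wc] Re_sum by (intro sum.cong) (simp_all only: w Sw lessThan_iff)
  qed
  then show ?thesis using Y by (simp add: obs_energy_def)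
qed

lemma measurable_mat_entry:
  assumes "q < n" "k < K"
  shows "(\<lambda>H. H $$ (q, k)) \<in> borel_measurable (lborel_mat n K)"
  unfolding lborel_mat_def
proof (rule measurable_embed_measure1)
  have "(\<lambda>f. f (q, k)) \<in> Pi\<^sub>M ({..<n} \<times> {..<K}) (\<lambda>_. lborel) \<rightarrow>\<^sub>M (lborel :: complex measure)"
    using assms by (intro measurable_component_singleton) auto
  then show "(\<lambda>f. Matrix.mat n K f $$ (q, k)) \<in> borel_measurable (Pi\<^sub>M ({..<n} \<times> {..<K}) (\<lambda>_. lborel))"
    using assms by simp
qed

lemma measurable_obs_energy:
  assumes S: "S \<in> carrier_mat r r" and X: "X \<in> carrier_mat r n" and Y: "Y \<in> carrier_mat r K"
  shows "obs_energy S X Y \<in> borel_measurable (lborel_mat n K)"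
proof -
  note measurable_mat_entry [measurable (raw)]
  have "(\<lambda>H. \<Sum>k<K. \<Sum>i<r. Re (
     (\<Sum>j<r. S $$ (i, j) * (Y $$ (j, k) - (\<Sum>q<n. X $$ (j, q) * H $$ (q, k)))) *
       cnj (Y $$ (i, k) - (\<Sum>q<n. X $$ (i, q) * H $$ (q, k))))) \<in> borel_measurable (lborel_mat n K)"
    by measurable
  then show ?thesis
    using obs_energy_entries [OF S X Y]
    by (subst measurable_cong) (auto simp: space_lborel_mat)
qed

text \<open>Here \<open>g q\<close> is the prior variance of row q in every column. The joint
  density \<open>J\<close> is prescribed only on matrices of the right size, which form the whole
  space of the measure, and only up to the factor \<open>c\<close>, which normalization
  removes.\<close>

locale gaussian_posterior =
  fixes r n K :: nat and X S Y \<Sigma> :: "complex mat" and g :: "nat \<Rightarrow> real"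
    and c :: real and J :: "complex mat \<Rightarrow> real"
  assumes S: "hermitian_pos_def r S" and X: "X \<in> carrier_mat r n" and Y: "Y \<in> carrier_mat r K"
    and g: "\<And>q. q < n \<Longrightarrow> 0 < g q" and c: "0 < c"
    and \<Sigma>: "\<Sigma> = mat_inv (mat_adjoint X * S * X + mat_diag n (\<lambda>q. complex_of_real (1 / g q)))"
    and J: "\<And>H. H \<in> carrier_mat n K \<Longrightarrow>
      J H = c * exp (- (obs_energy S X Y H + (\<Sum>k<K. \<Sum>q<n. (cmod (H $$ (q, k)))\<^sup>2 / g q)))"
begin

abbreviation "I \<equiv> {..<n} \<times> {..<K}"

abbreviation "D \<equiv> mat_diag n (\<lambda>q. complex_of_real (1 / g q))"

definition energy :: "complex mat \<Rightarrow> real" where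
  "energy H = obs_energy S X Y H + (\<Sum>k<K. \<Sum>q<n. (cmod (H $$ (q, k)))\<^sup>2 / g q)"

definition post :: "complex mat measure" where
  "post = density (lborel_mat n K) (\<lambda>H. ennreal (J H / (\<integral>H'. J H' \<partial>lborel_mat n K)))"

definition mean :: "nat \<Rightarrow> nat \<Rightarrow> complex" where
  "mean p k = (\<Sigma> *\<^sub>v (mat_adjoint X *\<^sub>v (S *\<^sub>v Matrix.col Y k))) $ p"

lemma D_pos: "hermitian_pos_def n D"
  using g by (intro hermitian_pos_def_mat_diag(1)) simp

lemma \<Sigma>_pos: "hermitian_pos_def n \<Sigma>"
  unfolding \<Sigma> by (intro hermitian_pos_def_mat_inv hermitian_pos_def_gram_add [OF S D_pos X])

lemma measurable_energy [measurable]: "energy \<in> borel_measurable (lborel_mat n K)"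
proof -
  note measurable_mat_entry [measurable (raw)]
  have "(\<lambda>H. \<Sum>k<K. \<Sum>q<n. (cmod (H $$ (q, k)))\<^sup>2 / g q) \<in> borel_measurable (lborel_mat n K)"
    by measurable
  then show ?thesis
    using measurable_obs_energy [OF hermitian_pos_defD(1) [OF S] X Y]
    unfolding energy_def [abs_def] by measurable
qed

lemma measurable_mat [measurable]:
  "Matrix.mat n K \<in> Pi\<^sub>M I (\<lambda>_. lborel) \<rightarrow>\<^sub>M lborel_mat n K"
  unfolding lborel_mat_def by (rule measurable_embed_measure2' [OF inj_on_mat_entries])

lemma nn_integral_lborel_mat:
  "f \<in> borel_measurable (lborel_mat n K) \<Longrightarrow>
    (\<integral>\<^sup>+H. f H \<partial>lborel_mat n K) = (\<integral>\<^sup>+h. f (Matrix.mat n K h) \<partial>Pi\<^sub>M I (\<lambda>_. lborel))"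
  unfolding lborel_mat_def by (rule nn_integral_embed_measure' [OF inj_on_mat_entries])

text \<open>The columns decouple: each contributes its own residual form and its own prior form, so
  a shift inside one column leaves the other terms unchanged.\<close>

lemma energy_mat:
  "energy (Matrix.mat n K h) = (\<Sum>k<K.
     Re ((S *\<^sub>v (Matrix.col Y k - X *\<^sub>v Matrix.vec n (\<lambda>q. h (q, k)))) \<bullet>c
         (Matrix.col Y k - X *\<^sub>v Matrix.vec n (\<lambda>q. h (q, k)))) +
     Re ((D *\<^sub>v Matrix.vec n (\<lambda>q. h (q, k))) \<bullet>c Matrix.vec n (\<lambda>q. h (q, k))))"
proof -
  have D: "Re ((D *\<^sub>v Matrix.vec n (\<lambda>q. h (q, k))) \<bullet>c Matrix.vec n (\<lambda>q. h (q, k)))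
      = (\<Sum>q<n. (cmod (Matrix.mat n K h $$ (q, k)))\<^sup>2 / g q)" if "k < K" for k
  proof -
    have "Re ((D *\<^sub>v Matrix.vec n (\<lambda>q. h (q, k))) \<bullet>c Matrix.vec n (\<lambda>q. h (q, k)))
      = (\<Sum>q<n. 1 / g q * (cmod (Matrix.vec n (\<lambda>q. h (q, k)) $ q))\<^sup>2)"
      using g by (subst hermitian_pos_def_mat_diag(2)) simp_all
    then show ?thesis using that by simp
  qed
  have "Matrix.col (Matrix.mat n K h) k = Matrix.vec n (\<lambda>q. h (q, k))" if "k < K" for k
    using that by simp
  moreover have "dim_col Y = K" using Y by simp
  ultimately show ?thesis
    unfolding energy_def obs_energy_def
    by (simp only: sum.distrib [symmetric]) (intro sum.cong, simp_all only: D lessThan_iff)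
qed

text \<open>Only column \<open>k\<close> moves, so \<open>posterior_energy_shift\<close> for that
  column suffices. The result has the form of the hypothesis \<open>shift\<close> of
  \<open>nn_integral_gaussian_marginal\<close>.\<close>

lemma energy_shift:
  assumes p: "p < n" and k: "k < K"
    and u: "u = complex_of_real (1 / Re (\<Sigma> $$ (p, p))) \<cdot>\<^sub>v Matrix.col \<Sigma> p"
    and hp: "h (p, k) = mean p k"
  shows "energy (Matrix.mat n K (\<lambda>i\<in>I. h i + t * (if snd i = k then u $ fst i else 0)))
    = energy (Matrix.mat n K h) + (cmod t)\<^sup>2 / Re (\<Sigma> $$ (p, p))"
proof -
  let ?h' = "\<lambda>i\<in>I. h i + t * (if snd i = k then u $ fst i else 0)"
  let ?e = "\<lambda>k v. Re ((S *\<^sub>v (Matrix.col Y k - X *\<^sub>v v)) \<bullet>c (Matrix.col Y k - X *\<^sub>v v)) +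
     Re ((D *\<^sub>v v) \<bullet>c v)"
  let ?a = "\<lambda>k. Matrix.vec n (\<lambda>q. h (q, k))"
  have uc: "u \<in> carrier_vec n"
    unfolding u using hermitian_pos_defD(1) [OF \<Sigma>_pos] by (intro smult_carrier_vec carrier_vecI) auto
  have other: "Matrix.vec n (\<lambda>q. ?h' (q, k')) = ?a k'" if "k' < K" "k' \<noteq> k" for k'
    using that by (intro eq_vecI) auto
  have shifted: "Matrix.vec n (\<lambda>q. ?h' (q, k)) = ?a k + t \<cdot>\<^sub>v u"
    using k uc by (intro eq_vecI) auto
  have "?e k (?a k + t \<cdot>\<^sub>v u) = ?e k (?a k) + (cmod t)\<^sup>2 / Re (\<Sigma> $$ (p, p))"
    using hermitian_pos_def_diag_entry [OF \<Sigma>_pos p] hp p Y k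
    by (intro posterior_energy_shift [OF S D_pos X _ _ p \<Sigma> _ _ u])
      (auto simp: mean_def intro: carrier_vecI)
  moreover have "energy (Matrix.mat n K ?h') = ?e k (?a k + t \<cdot>\<^sub>v u) + (\<Sum>k'\<in>{..<K} - {k}. ?e k' (?a k'))"
    unfolding energy_mat using k other
    by (subst sum.remove [of _ k]) (simp_all only: shifted, auto intro!: sum.cong)
  moreover have "energy (Matrix.mat n K h) = ?e k (?a k) + (\<Sum>k'\<in>{..<K} - {k}. ?e k' (?a k'))"
    unfolding energy_mat using k by (subst sum.remove [of _ k]) auto
  ultimately show ?thesis by simp
qed

text \<open>Extended nonnegative, so that it is meaningful before finiteness is known; the factor
  \<open>c\<close> is left out.\<close>

definition Z :: ennreal where "Z = (\<integral>\<^sup>+H. ennreal (exp (- energy H)) \<partial>lborel_mat n K)"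

lemma obs_energy_nonneg: "0 \<le> obs_energy S X Y H"
  unfolding obs_energy_def using X Y
  by (intro sum_nonneg hermitian_pos_def_nonneg [OF S] carrier_vecI) auto

text \<open>Dropping the nonnegative observation energy leaves the unnormalized prior, whose
  integral is a product of complex normal integrals.\<close>

lemma Z_finite: "Z < \<infinity>"
proof -
  interpret P: product_sigma_finite "\<lambda>_::nat \<times> nat. lborel :: complex measure" by standard
  have "Z = (\<integral>\<^sup>+h. ennreal (exp (- energy (Matrix.mat n K h))) \<partial>Pi\<^sub>M I (\<lambda>_. lborel))"
    unfolding Z_def by (rule nn_integral_lborel_mat) measurable
  also have "\<dots> \<le> (\<integral>\<^sup>+h. (\<Prod>i\<in>I. ennreal (pi * g (fst i)) * ennreal (complex_normal_density 0 (g (fst i)) (h i)))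
      \<partial>Pi\<^sub>M I (\<lambda>_. lborel))"
  proof (intro nn_integral_mono)
    fix h :: "nat \<times> nat \<Rightarrow> complex"
    have "(\<Sum>k<K. \<Sum>q<n. (cmod (Matrix.mat n K h $$ (q, k)))\<^sup>2 / g q) = (\<Sum>i\<in>I. (cmod (h i))\<^sup>2 / g (fst i))"
      by (subst sum.swap) (simp add: sum.cartesian_product case_prod_unfold)
    then have "exp (- energy (Matrix.mat n K h)) \<le> exp (- (\<Sum>i\<in>I. (cmod (h i))\<^sup>2 / g (fst i)))"
      using obs_energy_nonneg by (simp add: energy_def)
    also have "\<dots> = (\<Prod>i\<in>I. pi * g (fst i) * complex_normal_density 0 (g (fst i)) (h i))"
      using g by (auto simp: exp_sum complex_normal_density_def less_imp_neq [symmetric]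
          simp flip: sum_negf intro!: prod.cong)
    finally have "ennreal (exp (- energy (Matrix.mat n K h)))
        \<le> ennreal (\<Prod>i\<in>I. pi * g (fst i) * complex_normal_density 0 (g (fst i)) (h i))" by (rule ennreal_leI)
    also have "\<dots> = (\<Prod>i\<in>I. ennreal (pi * g (fst i)) * ennreal (complex_normal_density 0 (g (fst i)) (h i)))"
      using g by (subst prod_ennreal [symmetric])
        (auto intro!: prod.cong simp: less_imp_le ennreal_mult)
    finally show "ennreal (exp (- energy (Matrix.mat n K h)))
      \<le> (\<Prod>i\<in>I. ennreal (pi * g (fst i)) * ennreal (complex_normal_density 0 (g (fst i)) (h i)))" .
  qed
  also have "\<dots> = (\<Prod>i\<in>I. (\<integral>\<^sup>+z. ennreal (pi * g (fst i)) * ennreal (complex_normal_density 0 (g (fst i)) z) \<partial>lborel))"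
    by (rule P.product_nn_integral_prod) auto
  also have "\<dots> = (\<Prod>i\<in>I. ennreal (pi * g (fst i)))"
    using g by (intro prod.cong refl) (auto simp: nn_integral_cmult nn_integral_complex_normal_density)
  also have "\<dots> < \<infinity>"
    using g by (subst prod_ennreal) (auto simp: less_imp_le)
  finally show ?thesis .
qed

text \<open>The integrand is positive everywhere, so a zero integral would make the whole space a
  null set.\<close>

lemma Z_nonzero: "Z \<noteq> 0"
proof
  interpret P: product_sigma_finite "\<lambda>_::nat \<times> nat. lborel :: complex measure" by standard
  assume "Z = 0"
  moreover have "Z = (\<integral>\<^sup>+h. ennreal (exp (- energy (Matrix.mat n K h))) \<partial>Pi\<^sub>M I (\<lambda>_. lborel))"
    unfolding Z_def by (rule nn_integral_lborel_mat) measurable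
  ultimately have "(\<integral>\<^sup>+h. ennreal (exp (- energy (Matrix.mat n K h))) \<partial>Pi\<^sub>M I (\<lambda>_. lborel)) = 0"
    by simp
  then have "AE h in Pi\<^sub>M I (\<lambda>_. lborel). ennreal (exp (- energy (Matrix.mat n K h))) = 0"
    by (subst (asm) nn_integral_0_iff_AE) auto
  then have "AE h in Pi\<^sub>M I (\<lambda>_. lborel :: complex measure). False"
    by (rule AE_mp) (auto simp: ennreal_eq_0_iff not_le)
  then have "emeasure (Pi\<^sub>M I (\<lambda>_. lborel :: complex measure)) (space (Pi\<^sub>M I (\<lambda>_. lborel :: complex measure))) = 0"
    by (auto simp: AE_iff_measurable [OF sets.top])
  \<comment> \<open>This product of infinite factors is nonzero; over an empty index set it is
    1.\<close>
  moreover have "emeasure (Pi\<^sub>M I (\<lambda>_. lborel :: complex measure)) (Pi\<^sub>E I (\<lambda>_. UNIV)) = (\<Prod>i\<in>I. \<infinity>)"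
    by (subst P.emeasure_PiM) (auto simp: emeasure_lborel_UNIV)
  ultimately show False by (auto simp: space_PiM prod_zero_iff)
qed

lemma Z_real: "ennreal (enn2real Z) = Z" "0 < enn2real Z"
  using Z_finite Z_nonzero by (auto simp: enn2real_positive_iff top_unique less_top zero_less_iff_neq_zero)

text \<open>The factor \<open>c\<close> cancels between density and normalization. The Bochner
  integral in the denominator is the real value of \<open>Z\<close> times \<open>c\<close>, hence
  positive and finite.\<close>

lemma post_eq: "post = density (lborel_mat n K) (\<lambda>H. ennreal (exp (- energy H)) / Z)"
proof -
  have J': "J H = c * exp (- energy H)" if "H \<in> carrier_mat n K" for H
    using J [OF that] by (simp add: energy_def)
  have "(\<integral>H. J H \<partial>lborel_mat n K) = (\<integral>H. c * exp (- energy H) \<partial>lborel_mat n K)"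
    by (intro Bochner_Integration.integral_cong) (auto simp: space_lborel_mat J')
  also have "\<dots> = c * enn2real Z"
    unfolding Z_def by (simp add: integral_eq_nn_integral)
  finally have "(\<integral>H. J H \<partial>lborel_mat n K) = c * enn2real Z" .
  moreover have "ennreal (c * exp (- energy H) / (c * enn2real Z)) = ennreal (exp (- energy H)) / Z" for H
    using c Z_real divide_ennreal [of "exp (- energy H)" "enn2real Z"] by simp
  ultimately have eq: "ennreal (J H / (\<integral>H'. J H' \<partial>lborel_mat n K)) = ennreal (exp (- energy H)) / Z"
    if "H \<in> carrier_mat n K" for H
    using that by (simp add: J')
  \<comment> \<open>Replacing a density needs measurability of both versions; it is transferred from
    the explicit one, since they agree on the space.\<close>
  have m: "(\<lambda>H. ennreal (exp (- energy H)) / Z) \<in> borel_measurable (lborel_mat n K)"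
    by measurable
  also have "?this \<longleftrightarrow> (\<lambda>H. ennreal (J H / (\<integral>H'. J H' \<partial>lborel_mat n K))) \<in> borel_measurable (lborel_mat n K)"
    by (rule measurable_cong) (simp add: eq space_lborel_mat)
  finally show ?thesis
    unfolding post_def by (rule density_cong [OF _ m]) (auto simp: eq space_lborel_mat)
qed

lemma measurable_post: "f \<in> borel_measurable post \<longleftrightarrow> f \<in> borel_measurable (lborel_mat n K)"
  unfolding post_eq by simp

lemma prob_space_post: "prob_space post"
proof
  have "emeasure post (space post) = (\<integral>\<^sup>+H. ennreal (exp (- energy H)) / Z \<partial>lborel_mat n K)"
    unfolding post_eq by (subst emeasure_density) (auto intro!: nn_integral_cong simp: indicator_def)
  also have "\<dots> = Z / Z"
    unfolding Z_def by (rule nn_integral_divide) measurable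
  also have "\<dots> = 1"
    using Z_finite Z_nonzero by (intro ennreal_divide_self) auto
  finally show "emeasure post (space post) = 1" .
qed

text \<open>Each entry has a complex normal marginal. The integral is pulled back to families of
  entries, the shear direction is extended by 0 to the other columns, and the total mass left by the
  marginal lemma is \<open>Z\<close>.\<close>

lemma nn_integral_post_entry:
  fixes \<phi> :: "complex \<Rightarrow> ennreal"
  assumes p: "p < n" and k: "k < K" and \<phi> [measurable]: "\<phi> \<in> borel_measurable borel"
  shows "(\<integral>\<^sup>+H. \<phi> (H $$ (p, k)) \<partial>post)
    = (\<integral>\<^sup>+z. \<phi> z * ennreal (complex_normal_density (mean p k) (Re (\<Sigma> $$ (p, p))) z) \<partial>lborel)"
proof -
  define u where "u = complex_of_real (1 / Re (\<Sigma> $$ (p, p))) \<cdot>\<^sub>v Matrix.col \<Sigma> p"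
  note [measurable] = measurable_mat_entry [OF p k]
  have up: "u $ p = 1"
    using hermitian_pos_def_diag_entry [OF \<Sigma>_pos p] hermitian_pos_defD(1) [OF \<Sigma>_pos] p
    by (simp add: u_def complex_eq_iff)
  have "(\<integral>\<^sup>+H. \<phi> (H $$ (p, k)) * ennreal (exp (- energy H)) \<partial>lborel_mat n K)
      = (\<integral>\<^sup>+h. \<phi> (h (p, k)) * ennreal (exp (- energy (Matrix.mat n K h))) \<partial>Pi\<^sub>M I (\<lambda>_. lborel))"
    using p k by (subst nn_integral_lborel_mat) auto
  also have "\<dots> = (\<integral>\<^sup>+z. \<phi> z * ennreal (complex_normal_density (mean p k) (Re (\<Sigma> $$ (p, p))) z) \<partial>lborel) *
      (\<integral>\<^sup>+h. ennreal (exp (- energy (Matrix.mat n K h))) \<partial>Pi\<^sub>M I (\<lambda>_. lborel))"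
    using p k up hermitian_pos_def_diag_entry(2) [OF \<Sigma>_pos p]
    by (intro nn_integral_gaussian_marginal [where u = "\<lambda>i. if snd i = k then u $ fst i else 0"]
        energy_shift [OF p k u_def]) auto
  also have "(\<integral>\<^sup>+h. ennreal (exp (- energy (Matrix.mat n K h))) \<partial>Pi\<^sub>M I (\<lambda>_. lborel)) = Z"
    unfolding Z_def by (rule nn_integral_lborel_mat [symmetric]) measurable
  finally have eq: "(\<integral>\<^sup>+H. \<phi> (H $$ (p, k)) * ennreal (exp (- energy H)) \<partial>lborel_mat n K)
      = (\<integral>\<^sup>+z. \<phi> z * ennreal (complex_normal_density (mean p k) (Re (\<Sigma> $$ (p, p))) z) \<partial>lborel) * Z" .
  have "(\<integral>\<^sup>+H. \<phi> (H $$ (p, k)) \<partial>post)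
      = (\<integral>\<^sup>+H. \<phi> (H $$ (p, k)) * ennreal (exp (- energy H)) / Z \<partial>lborel_mat n K)"
    unfolding post_eq
    by (subst nn_integral_density) (auto intro!: nn_integral_cong simp: ennreal_times_divide mult.commute)
  also have "\<dots> = (\<integral>\<^sup>+H. \<phi> (H $$ (p, k)) * ennreal (exp (- energy H)) \<partial>lborel_mat n K) / Z"
    by (rule nn_integral_divide) measurable
  also have "\<dots> = (\<integral>\<^sup>+z. \<phi> z * ennreal (complex_normal_density (mean p k) (Re (\<Sigma> $$ (p, p))) z) \<partial>lborel)"
    unfolding eq using Z_finite Z_nonzero by (intro ennreal_mult_divide_eq) auto
  finally show ?thesis .
qed

lemma post_second_moment:
  assumes p: "p < n" and k: "k < K"
  shows "has_bochner_integral post (\<lambda>H. (cmod (H $$ (p, k)))\<^sup>2)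
    ((cmod (mean p k))\<^sup>2 + Re (\<Sigma> $$ (p, p)))"
proof (rule has_bochner_integral_nn_integral)
  note [measurable] = measurable_mat_entry [OF p k]
  note s = hermitian_pos_def_diag_entry(2) [OF \<Sigma>_pos p]
  show "(\<lambda>H. (cmod (H $$ (p, k)))\<^sup>2) \<in> borel_measurable post"
    unfolding measurable_post by measurable
  show "(\<integral>\<^sup>+H. ennreal ((cmod (H $$ (p, k)))\<^sup>2) \<partial>post)
      = ennreal ((cmod (mean p k))\<^sup>2 + Re (\<Sigma> $$ (p, p)))"
    using nn_integral_post_entry [OF p k, of "\<lambda>z. ennreal ((cmod z)\<^sup>2)"]
    by (simp add: nn_integral_complex_normal_density_square [OF s])
  show "0 \<le> (cmod (mean p k))\<^sup>2 + Re (\<Sigma> $$ (p, p))" using s by simp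
qed simp

text \<open>The EM objective contains the expectation of this energy. Without integrability the
  Bochner integral could not be split into the observation part and the prior part.\<close>

lemma integrable_obs_energy: "integrable post (obs_energy S X Y)"
proof -
  interpret prob_space post by (rule prob_space_post)
  have entry: "square_integrable post (\<lambda>H. H $$ (p, k))" if "p < n" "k < K" for p k
    using post_second_moment [OF that] measurable_mat_entry [OF that]
    by (auto simp: square_integrable_def measurable_post has_bochner_integral_iff)
  have res: "square_integrable post (\<lambda>H. Y $$ (i, k) - (\<Sum>q<n. X $$ (i, q) * H $$ (q, k)))"
    if "k < K" for i k
  proof -
    have "square_integrable post (\<lambda>H. Y $$ (i, k) + (- 1) * (\<Sum>q<n. X $$ (i, q) * H $$ (q, k)))"
      using that by (intro square_integrable_add square_integrable_const square_integrable_cmult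
          square_integrable_sum entry) auto
    then show ?thesis by simp
  qed
  have "integrable post (\<lambda>H. \<Sum>k<K. \<Sum>i<r. Re (
     (\<Sum>j<r. S $$ (i, j) * (Y $$ (j, k) - (\<Sum>q<n. X $$ (j, q) * H $$ (q, k)))) *
       cnj (Y $$ (i, k) - (\<Sum>q<n. X $$ (i, q) * H $$ (q, k)))))"
    by (intro Bochner_Integration.integrable_sum integrable_Re square_integrable_mult_cnj
        square_integrable_sum square_integrable_cmult res) auto
  moreover have "space post = carrier_mat n K" by (simp add: post_eq space_lborel_mat)
  ultimately show ?thesis
    using obs_energy_entries [OF hermitian_pos_defD(1) [OF S] X Y]
    by (subst Bochner_Integration.integrable_cong [OF refl]) auto
qed

end

section \<open>The EM update\<close>

text \<open>With x = S / (C t), the gap between the bound and the value at \<open>t\<close> is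
  exactly C (x - 1 - ln x), which is nonnegative and vanishes only at x = 1.\<close>

lemma inverse_gamma_objective_le:
  fixes C S t :: real
  assumes C: "0 < C" and S: "0 < S" and t: "0 < t"
  shows "- C * ln (pi * t) - S / t \<le> - C * ln (pi * (S / C)) - C"
    and "- C * ln (pi * t) - S / t = - C * ln (pi * (S / C)) - C \<longleftrightarrow> t = S / C"
proof -
  let ?x = "S / (C * t)"
  have x: "0 < ?x" using assms by simp
  have "C * ln ?x = C * ln (pi * (S / C)) - C * ln (pi * t)"
    using assms by (simp add: ln_mult ln_div algebra_simps)
  moreover have "C * ?x = S / t" using C by simp
  ultimately have gap: "(- C * ln (pi * (S / C)) - C) - (- C * ln (pi * t) - S / t)
      = C * (?x - 1 - ln ?x)"
    by (simp add: right_diff_distrib)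
  have nonneg: "0 \<le> C * (?x - 1 - ln ?x)"
    using C ln_le_minus_one [OF x] by simp
  then show "- C * ln (pi * t) - S / t \<le> - C * ln (pi * (S / C)) - C"
    using gap by linarith
  have "C * (?x - 1 - ln ?x) = 0 \<longleftrightarrow> ?x = 1"
    using C ln_eq_minus_one [OF x] by auto
  also have "\<dots> \<longleftrightarrow> t = S / C" using assms by (auto simp: field_simps)
  finally show "- C * ln (pi * t) - S / t = - C * ln (pi * (S / C)) - C \<longleftrightarrow> t = S / C"
    using gap by (metis eq_iff_diff_eq_0)
qed

text \<open>The coordinates can be maximized independently, and each has a unique maximizer.
  Positivity of every \<open>S i\<close> places the resulting vector in the open domain.\<close>

lemma is_arg_max_separable:
  fixes F :: "real Matrix.vec \<Rightarrow> real" and S :: "nat \<Rightarrow> real"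
  assumes C: "0 < C" and S: "\<And>i. i < r \<Longrightarrow> 0 < S i"
    and F: "\<And>\<psi>. \<psi> \<in> pos_vecs r \<Longrightarrow> F \<psi> = c + (\<Sum>i<r. - C * ln (pi * \<psi> $ i) - S i / \<psi> $ i)"
  shows "is_arg_max F (\<lambda>\<psi>. \<psi> \<in> pos_vecs r) \<psi> \<longleftrightarrow> \<psi> = Matrix.vec r (\<lambda>i. S i / C)"
proof -
  let ?o = "Matrix.vec r (\<lambda>i. S i / C)"
  define T where "T = (\<Sum>i<r. - C * ln (pi * (S i / C)) - C)"
  have o: "?o \<in> pos_vecs r" using C S by (auto simp: pos_vecs_def)
  have Fo: "F ?o = c + T"
  proof -
    have "- C * ln (pi * (S i / C)) - S i / (S i / C) = - C * ln (pi * (S i / C)) - C" if "i < r" for i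
      using inverse_gamma_objective_le(2) [OF C S [OF that], of "S i / C"] C S [OF that] by simp
    then show ?thesis unfolding F [OF o] T_def by (intro arg_cong2 [where f = "(+)"] sum.cong refl) auto
  qed
  have le: "F \<phi> \<le> c + T" if "\<phi> \<in> pos_vecs r" for \<phi>
    unfolding F [OF that] T_def
    using that by (intro add_left_mono sum_mono inverse_gamma_objective_le(1) C S)
      (auto simp: pos_vecs_def)
  have eq: "\<phi> = ?o" if \<phi>: "\<phi> \<in> pos_vecs r" "F \<phi> = c + T" for \<phi>
  proof (rule eq_vecI)
    show "dim_vec \<phi> = dim_vec ?o" using \<phi>(1) by (auto simp: pos_vecs_def)
    fix i assume "i < dim_vec ?o"
    then have i: "i < r" by simp
    have pos: "0 < \<phi> $ j" if "j < r" for j using \<phi>(1) that by (auto simp: pos_vecs_def)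
    have "- C * ln (pi * \<phi> $ i) - S i / \<phi> $ i = - C * ln (pi * (S i / C)) - C"
    \<comment> \<open>Equal sums with termwise inequality force equality in every term, so a vector
      attaining the bound is optimal in each coordinate.\<close>
    proof (rule sum_mono_inv [of _ "{..<r}"])
      show "(\<Sum>i<r. - C * ln (pi * \<phi> $ i) - S i / \<phi> $ i) = (\<Sum>i<r. - C * ln (pi * (S i / C)) - C)"
        using \<phi>(2) unfolding F [OF \<phi>(1)] T_def by simp
      show "- C * ln (pi * \<phi> $ j) - S j / \<phi> $ j \<le> - C * ln (pi * (S j / C)) - C"
        if "j \<in> {..<r}" for j
        using that pos by (intro inverse_gamma_objective_le(1) C S) auto
    qed (use i in auto)
    then show "\<phi> $ i = ?o $ i"
      using inverse_gamma_objective_le(2) [OF C S [OF i] pos [OF i]] i by simp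
  qed
  show ?thesis
  proof
    assume m: "is_arg_max F (\<lambda>\<psi>. \<psi> \<in> pos_vecs r) \<psi>"
    then have "\<psi> \<in> pos_vecs r" "\<not> F \<psi> < F ?o" using o by (auto simp: is_arg_max_def)
    then show "\<psi> = ?o" using eq le Fo by force
  next
    assume "\<psi> = ?o"
    then show "is_arg_max F (\<lambda>\<psi>. \<psi> \<in> pos_vecs r) \<psi>"
      using o le Fo by (force simp: is_arg_max_def not_less)
  qed
qed

lemma likelihood_eq:
  assumes Rv: "hermitian_pos_def r Rv" and X: "X \<in> carrier_mat r n" and Y: "Y \<in> carrier_mat r K"
    and H: "H \<in> carrier_mat n K"
  shows "likelihood X Rv Y H
    = (1 / (pi ^ r * Re (Determinant.det Rv))) ^ K * exp (- obs_energy (mat_inv Rv) X Y H)"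
proof -
  have col: "Matrix.col (Y - X * H) k = Matrix.col Y k - X *\<^sub>v Matrix.col H k" if "k < K" for k
    using X Y H that by (intro eq_vecI) auto
  have "likelihood X Rv Y H = (\<Prod>k<K. 1 / (pi ^ r * Re (Determinant.det Rv)) *
      exp (- Re ((mat_inv Rv *\<^sub>v (Matrix.col Y k - X *\<^sub>v Matrix.col H k)) \<bullet>c
        (Matrix.col Y k - X *\<^sub>v Matrix.col H k))))"
    unfolding likelihood_def noise_density_def cn_density_def
  proof (rule prod.cong)
    show "{..<dim_col (Y - X * H)} = {..<K}" using H by simp
    have "dim_row Rv = r" using hermitian_pos_defD(1) [OF Rv] by simp
    then show "1 / (pi ^ dim_row Rv * Re (Determinant.det Rv)) *
        exp (- Re ((mat_inv Rv *\<^sub>v Matrix.col (Y - X * H) k) \<bullet>c Matrix.col (Y - X * H) k))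
      = 1 / (pi ^ r * Re (Determinant.det Rv)) *
        exp (- Re ((mat_inv Rv *\<^sub>v (Matrix.col Y k - X *\<^sub>v Matrix.col H k)) \<bullet>c
          (Matrix.col Y k - X *\<^sub>v Matrix.col H k)))" if "k \<in> {..<K}" for k
      using that by (simp only: col lessThan_iff)
  qed
  also have "\<dots> = (1 / (pi ^ r * Re (Determinant.det Rv))) ^ K *
      exp (\<Sum>k<K. - Re ((mat_inv Rv *\<^sub>v (Matrix.col Y k - X *\<^sub>v Matrix.col H k)) \<bullet>c
        (Matrix.col Y k - X *\<^sub>v Matrix.col H k)))"
    unfolding prod.distrib prod_constant card_lessThan exp_sum [OF finite_lessThan] ..
  finally show ?thesis
    using Y unfolding obs_energy_def sum_negf by simp
qed

lemma obs_mat_carrier: "obs_mat N M L R x \<in> carrier_mat (M * (L + R - 1)) (N * M * R)"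
  by (intro carrier_matI) (simp_all add: obs_mat_def kron_def waveform_mat_def mult_ac)

text \<open>A Bochner integral of a non-integrable function is 0 by default, so the integrability
  clause certifies that the objective is a genuine expectation. Unique existence keeps the final
  implication from being vacuous.\<close>

theorem theorem3:
  fixes N M R K L d :: nat
    and x :: "nat \<Rightarrow> nat \<Rightarrow> complex"
    and Xt Rv Y \<Sigma> \<M> :: "complex mat"
    and \<psi>_old :: "real Matrix.vec"
  assumes "0 < N" "0 < M" "0 < R" "0 < K" "0 < L" "0 < d" "d dvd R"
    and "Xt = obs_mat N M L R x"
    and "hermitian_pos_def (M * (L + R - 1)) Rv"
    and "Y \<in> carrier_mat (M * (L + R - 1)) K"
    and "\<psi>_old \<in> pos_vecs (R div d)"
    and "\<Sigma> = post_cov Xt Rv (Psi_JG N M R d \<psi>_old)"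
    and "\<M> = post_mean Xt Rv (Psi_JG N M R d \<psi>_old) Y"
  shows "(\<forall>\<psi> \<in> pos_vecs (R div d).
            integrable (posterior N M R K d Xt Rv \<psi>_old Y)
              (\<lambda>H. ln (joint_density N M R K d Xt Rv \<psi> Y H))) \<and>
         (\<exists>!\<psi>. is_arg_max (EM_objective N M R K d Xt Rv Y \<psi>_old)
                  (\<lambda>\<psi>. \<psi> \<in> pos_vecs (R div d)) \<psi>) \<and>
         (\<forall>\<psi>. is_arg_max (EM_objective N M R K d Xt Rv Y \<psi>_old)
                  (\<lambda>\<psi>. \<psi> \<in> pos_vecs (R div d)) \<psi> \<longrightarrow>
            (\<forall>i < R div d.
               complex_of_real (\<psi> $ i) =
                 1 / of_nat (d * N * M * K) *
                   (\<Sum>n<N. \<Sum>m<M. \<Sum>k<K. \<Sum>j = i * d..<(i + 1) * d.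
                      complex_of_real ((cmod (\<M> $$ (m * N * R + n * R + j, k)))\<^sup>2)) +
                 1 / of_nat (d * N * M) *
                   (\<Sum>n<N. \<Sum>m<M. \<Sum>j = i * d..<(i + 1) * d.
                      \<Sigma> $$ (m * N * R + n * R + j, m * N * R + n * R + j))))"
proof -

  \<comment> \<open>The model as an instance of the abstract Gaussian posterior\<close>
  define r where "r = M * (L + R - 1)"
  define nn where "nn = N * M * R"
  define S where "S = mat_inv Rv"
  define g where "g = (\<lambda>q. \<psi>_old $ (q mod R div d))"
  define cL where "cL = (1 / (pi ^ r * Re (Determinant.det Rv))) ^ K"
  define cP where "cP = (\<lambda>\<psi> :: real Matrix.vec. (\<Prod>i<R div d. 1 / (pi * \<psi> $ i) ^ d) ^ (N * M * K))"
  define prE where "prE = (\<lambda>(\<psi> :: real Matrix.vec) H :: complex mat. \<Sum>n<N. \<Sum>m<M. \<Sum>k<K. \<Sum>i<R div d.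
      (\<Sum>j = i * d..<(i + 1) * d. (cmod (H $$ (m * N * R + n * R + j, k)))\<^sup>2) / \<psi> $ i)"
  let ?J = "joint_density N M R K d Xt Rv \<psi>_old Y"
  have d: "0 < d" "d dvd R" by fact+
  have Rv: "hermitian_pos_def r Rv" and Y: "Y \<in> carrier_mat r K" and X: "Xt \<in> carrier_mat r nn"
    using assms(8-10) obs_mat_carrier by (simp_all add: r_def nn_def)
  have S: "hermitian_pos_def r S" unfolding S_def by (rule hermitian_pos_def_mat_inv [OF Rv])
  have block: "q mod R div d < R div d" for q
    using \<open>0 < R\<close> d by (metis div_less_iff_less_mult dvd_div_mult_self mod_less_divisor)
  have g: "0 < g q" for q
    using assms(11) block by (auto simp: g_def pos_vecs_def)
  have cL: "0 < cL" using det_hermitian_pos_def [OF Rv] by (simp add: cL_def)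
  have cP: "0 < cP \<psi>" if "\<psi> \<in> pos_vecs (R div d)" for \<psi>
    using that by (auto simp: cP_def pos_vecs_def intro!: zero_less_power prod_pos)
  have joint: "joint_density N M R K d Xt Rv \<psi> Y H
      = cL * cP \<psi> * exp (- (obs_energy S Xt Y H + prE \<psi> H))" if "H \<in> carrier_mat nn K" for \<psi> H
    unfolding joint_density_def likelihood_eq [OF Rv X Y that] prior_density_eq [OF d(2)]
    by (simp add: cL_def cP_def prE_def S_def exp_diff exp_minus divide_inverse mult_ac)
  have Psi: "mat_inv (Psi_JG N M R d \<psi>_old) = mat_diag nn (\<lambda>q. complex_of_real (1 / g q))"
    unfolding Psi_JG_eq_diag [OF d] nn_def using g
    by (subst hermitian_pos_def_mat_diag(3)) (simp_all add: g_def)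
  have \<Sigma>: "\<Sigma> = mat_inv (mat_adjoint Xt * S * Xt + mat_diag nn (\<lambda>q. complex_of_real (1 / g q)))"
    unfolding assms(12) post_cov_def Psi S_def ..
  interpret G: gaussian_posterior r nn K Xt S Y \<Sigma> g "cL * cP \<psi>_old" ?J
  proof
    show "0 < cL * cP \<psi>_old" using cL cP assms(11) by simp
    show "?J H = cL * cP \<psi>_old * exp (- (obs_energy S Xt Y H +
        (\<Sum>k<K. \<Sum>q<nn. (cmod (H $$ (q, k)))\<^sup>2 / g q)))" if "H \<in> carrier_mat nn K" for H
      unfolding joint [OF that] prE_def g_def nn_def
      by (simp only: sum_prior_energy [OF d, where h = "\<lambda>q k. (cmod (H $$ (q, k)))\<^sup>2"])
  qed (use S X Y g \<Sigma> in auto)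
  have post: "posterior N M R K d Xt Rv \<psi>_old Y = G.post"
    by (simp only: posterior_def G.post_def nn_def [symmetric])
  interpret prob_space G.post by (rule G.prob_space_post)
  have space: "space G.post = carrier_mat nn K" by (simp add: G.post_eq space_lborel_mat)

  \<comment> \<open>Closed form of the EM objective and its maximizer\<close>
  define V where "V = (\<lambda>q k. (cmod (G.mean q k))\<^sup>2 + Re (\<Sigma> $$ (q, q)))"
  \<comment> \<open>\<open>T i\<close> is the posterior expectation of the energy in group
    \<open>i\<close>, and \<open>C\<close> counts the entries of \<open>H\<close> governed by one
    hyperparameter.\<close>
  define T where "T = (\<lambda>i. \<Sum>n<N. \<Sum>m<M. \<Sum>k<K. \<Sum>j = i * d..<(i + 1) * d. V (m * N * R + n * R + j) k)"
  define C where "C = real (d * N * M * K)"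
  have idx: "m * N * R + n * R + j < nn" if "n < N" "m < M" "i < R div d" "j < (i + 1) * d" for n m i j
    unfolding nn_def using that block_less [OF d(2)] by (intro channel_index_less) auto
  have prE: "has_bochner_integral G.post (prE \<psi>) (\<Sum>i<R div d. T i / \<psi> $ i)" for \<psi>
  proof -
    have "has_bochner_integral G.post (prE \<psi>) (\<Sum>n<N. \<Sum>m<M. \<Sum>k<K. \<Sum>i<R div d.
        (\<Sum>j = i * d..<(i + 1) * d. V (m * N * R + n * R + j) k) / \<psi> $ i)"
      unfolding prE_def V_def
      by (intro has_bochner_integral_sum has_bochner_integral_divide_zero G.post_second_moment)
        (auto intro: idx)
    also have "(\<Sum>n<N. \<Sum>m<M. \<Sum>k<K. \<Sum>i<R div d.
        (\<Sum>j = i * d..<(i + 1) * d. V (m * N * R + n * R + j) k) / \<psi> $ i) = (\<Sum>i<R div d. T i / \<psi> $ i)"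
      by (simp only: T_def sum_divide_distrib sum.swap [of _ "{..<R div d}"])
    finally show ?thesis .
  qed
  have obs: "integrable G.post (obs_energy S Xt Y)" by (rule G.integrable_obs_energy)
  have ln_joint: "ln (joint_density N M R K d Xt Rv \<psi> Y H)
      = ln cL + ln (cP \<psi>) - obs_energy S Xt Y H - prE \<psi> H"
    if "\<psi> \<in> pos_vecs (R div d)" "H \<in> space G.post" for \<psi> H
    using that cL cP [OF that(1)] by (simp add: joint space ln_mult)
  have int: "integrable G.post (\<lambda>H. ln (joint_density N M R K d Xt Rv \<psi> Y H))"
    if "\<psi> \<in> pos_vecs (R div d)" for \<psi>
    using obs has_bochner_integral_iff [THEN iffD1, OF prE [of \<psi>]]
    by (subst Bochner_Integration.integrable_cong [OF refl ln_joint [OF that]]) auto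
  have ln_cP: "ln (cP \<psi>) = (\<Sum>i<R div d. - C * ln (pi * \<psi> $ i))"
    if "\<psi> \<in> pos_vecs (R div d)" for \<psi>
  proof -
    have pos: "0 < \<psi> $ i" if "i < R div d" for i
      using that \<open>\<psi> \<in> _\<close> by (auto simp: pos_vecs_def)
    have "ln (cP \<psi>) = real (N * M * K) * (\<Sum>i<R div d. ln (1 / (pi * \<psi> $ i) ^ d))"
      unfolding cP_def ln_realpow using pos
      by (intro arg_cong2 [where f = "(*)"] refl ln_prod) (auto simp: less_imp_neq [symmetric])
    also have "\<dots> = (\<Sum>i<R div d. real (N * M * K) * (- real d * ln (pi * \<psi> $ i)))"
      unfolding sum_distrib_left using pos
      by (intro sum.cong refl arg_cong2 [where f = "(*)"]) (simp add: ln_div ln_realpow)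
    finally show ?thesis by (simp add: C_def mult_ac)
  qed
  \<comment> \<open>Collects everything that is independent of the new hyperparameters.\<close>
  define A where "A = ln cL - (\<integral>H. obs_energy S Xt Y H \<partial>G.post)"
  have objective: "EM_objective N M R K d Xt Rv Y \<psi>_old \<psi>
      = A + (\<Sum>i<R div d. - C * ln (pi * \<psi> $ i) - T i / \<psi> $ i)"
    if \<psi>: "\<psi> \<in> pos_vecs (R div d)" for \<psi>
  proof -
    have "EM_objective N M R K d Xt Rv Y \<psi>_old \<psi>
        = (\<integral>H. ln cL + ln (cP \<psi>) - obs_energy S Xt Y H - prE \<psi> H \<partial>G.post)"
      unfolding EM_objective_def post
      by (rule Bochner_Integration.integral_cong [OF refl ln_joint [OF \<psi>]])
    also have "\<dots> = ln cL + ln (cP \<psi>) - (\<integral>H. obs_energy S Xt Y H \<partial>G.post) - (\<Sum>i<R div d. T i / \<psi> $ i)"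
      using obs has_bochner_integral_iff [THEN iffD1, OF prE [of \<psi>]] by (simp add: prob_space)
    finally show ?thesis
      by (simp add: A_def ln_cP [OF \<psi>] sum_subtractf)
  qed
  have C: "0 < C" using assms(1-6) by (simp add: C_def)
  \<comment> \<open>Strictness comes from the posterior variance, since the mean may vanish. It
    makes every candidate T i / C positive.\<close>
  have V: "0 < V q k" if "q < nn" for q k
    unfolding V_def using hermitian_pos_def_diag_entry(2) [OF G.\<Sigma>_pos that]
    by (intro add_nonneg_pos) auto
  have T: "0 < T i" if "i < R div d" for i
    unfolding T_def using assms(1-6) that
    by (intro sum_pos V) (auto intro: idx)
  have argmax: "is_arg_max (EM_objective N M R K d Xt Rv Y \<psi>_old) (\<lambda>\<psi>. \<psi> \<in> pos_vecs (R div d)) \<psi>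
      \<longleftrightarrow> \<psi> = Matrix.vec (R div d) (\<lambda>i. T i / C)" for \<psi>
    by (rule is_arg_max_separable [OF C T objective])

  \<comment> \<open>Agreement with the stated mean and covariance formula\<close>
  have mean: "\<M> $$ (q, k) = G.mean q k" if "q < nn" "k < K" for q k
  proof -
    note X' = mat_adjoint_carrier [OF X] and Sc = hermitian_pos_defD(1) [OF S]
      and \<Sigma>c = hermitian_pos_defD(1) [OF G.\<Sigma>_pos]
    have yk: "Matrix.col Y k \<in> carrier_vec r" using Y by (intro carrier_vecI) auto
    have "\<M> = \<Sigma> * mat_adjoint Xt * S * Y"
      unfolding assms(13) post_mean_def S_def assms(12) ..
    moreover have "(\<Sigma> * mat_adjoint Xt * S * Y) $$ (q, k) = ((\<Sigma> * mat_adjoint Xt * S) *\<^sub>v Matrix.col Y k) $ q"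
      using that \<Sigma>c Y by simp
    moreover have "(\<Sigma> * mat_adjoint Xt * S) *\<^sub>v Matrix.col Y k
        = \<Sigma> *\<^sub>v (mat_adjoint Xt *\<^sub>v (S *\<^sub>v Matrix.col Y k))"
      using assoc_mult_mat_vec [OF mult_carrier_mat [OF \<Sigma>c X'] Sc yk]
        assoc_mult_mat_vec [OF \<Sigma>c X' mult_mat_vec_carrier [OF Sc yk]] by simp
    ultimately show ?thesis by (simp add: G.mean_def)
  qed
  have formula: "complex_of_real (T i / C) = 1 / of_nat (d * N * M * K) *
                   (\<Sum>n<N. \<Sum>m<M. \<Sum>k<K. \<Sum>j = i * d..<(i + 1) * d.
                      complex_of_real ((cmod (\<M> $$ (m * N * R + n * R + j, k)))\<^sup>2)) +
                 1 / of_nat (d * N * M) *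
                   (\<Sum>n<N. \<Sum>m<M. \<Sum>j = i * d..<(i + 1) * d.
                      \<Sigma> $$ (m * N * R + n * R + j, m * N * R + n * R + j))" if i: "i < R div d" for i
  proof -
    let ?P = "\<Sum>n<N. \<Sum>m<M. \<Sum>k<K. \<Sum>j = i * d..<(i + 1) * d.
                      (cmod (\<M> $$ (m * N * R + n * R + j, k)))\<^sup>2"
    let ?Q = "\<Sum>n<N. \<Sum>m<M. \<Sum>j = i * d..<(i + 1) * d.
                      Re (\<Sigma> $$ (m * N * R + n * R + j, m * N * R + n * R + j))"
    have "T i = (\<Sum>n<N. \<Sum>m<M. \<Sum>k<K. \<Sum>j = i * d..<(i + 1) * d.
        (cmod (\<M> $$ (m * N * R + n * R + j, k)))\<^sup>2 +
          Re (\<Sigma> $$ (m * N * R + n * R + j, m * N * R + n * R + j)))"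
      unfolding T_def V_def using idx [OF _ _ i] by (intro sum.cong refl) (simp add: mean)
    \<comment> \<open>The variances are the same for all pulses, so summing over \<open>k\<close>
      gives a factor \<open>K\<close>. It cancels against the \<open>K\<close> in \<open>C\<close>,
      which explains the different prefactors of the two sums.\<close>
    also have "\<dots> = ?P + real K * ?Q"
      by (simp only: sum.distrib sum_constant card_lessThan sum_distrib_left)
    finally have "T i / C = 1 / real (d * N * M * K) * ?P + 1 / real (d * N * M) * ?Q"
      using \<open>0 < K\<close> by (simp add: C_def add_divide_distrib)
    then have "complex_of_real (T i / C) = complex_of_real (1 / real (d * N * M * K) * ?P + 1 / real (d * N * M) * ?Q)"
      by simp
    also have "\<dots> = 1 / of_nat (d * N * M * K) * complex_of_real ?P + 1 / of_nat (d * N * M) * complex_of_real ?Q"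
      by simp
    \<comment> \<open>The diagonal entries of the Hermitian matrix \<open>\<Sigma>\<close> are real,
      so taking real parts loses nothing.\<close>
    also have "complex_of_real ?Q = (\<Sum>n<N. \<Sum>m<M. \<Sum>j = i * d..<(i + 1) * d.
                      \<Sigma> $$ (m * N * R + n * R + j, m * N * R + n * R + j))"
      unfolding of_real_sum using idx [OF _ _ i]
      by (intro sum.cong refl hermitian_pos_def_diag_entry(1) [OF G.\<Sigma>_pos, symmetric]) auto
    finally show ?thesis by (simp only: of_real_sum)
  qed
  show ?thesis
    unfolding argmax post using int formula by simp
qed

end
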